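(* Let $C,D$ be XOR-clauses, $I:=C\cap D$, and assume $\mathrm{var}(C)\cap\mathrm{var}(D)=\mathrm{var}(I)$, $|I|\ge2$, $|C|>|I|$ and $|D|>|I|$. Choose a variable $s\notin\mathrm{var}(C)\cup\mathrm{var}(D)$, and let $I':=I\cup\{s\}$, $C':=(C\setminus I)\cup\{s\}$, $D':=(D\setminus I)\cup\{s\}$. Then the XOR-clause-set $\{I',C',D'\}$ represents the XOR-clause-set $\{C,D\}$, and $X_2(C,D):=X_1(\{I',C',D'\})$ is an absolute forcing representation of the XOR-clause-set $\{C,D\}$.
   Context: Clauses are finite sets of literals without complementary pairs, clause-sets finite sets of clauses read as CNF ($\top$ empty clause-set, $\bot$ empty clause); $\varphi*F$ applies a partial assignment. A literal $x$ is forced for $F$ if $\langle x\to0\rangle*F$ is unsatisfiable; $r_1$ is unit-clause propagation. An XOR-clause $C$ denotes $\bigoplus_{x\in C}x=0$ over $\mathbb{Z}_2$ (with $\overline v$ valued $1\oplus v$); an XOR-clause-set is a conjunction. An XOR-clause-set $F'$ represents an XOR-clause-set $F$ if the satisfying total assignments of $F'$ projected to $\mathrm{var}(F)$ are precisely those of $F$. $X_0(C)$: all clauses $E$ with $\mathrm{var}(E)=\mathrm{var}(C)$ whose number of complemented literals has parity different from that in $C$. Natural splitting of $C=\{x_1,\dots,x_n\}$ (in some order): $\{C\}$ if $n\le2$, else XOR-clauses $\{x_1,x_2,y_2\}$, $\{y_{i-1},x_i,y_i\}$ ($3\le i\le n-1$), $\{y_{n-1},x_n\}$ with new variables; $X_1(C)$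 is $X_0$ applied clausewise to it, $X_1(F)=\bigcup_{C\in F}X_1(C)$ with disjoint new variables. A CNF-representation of XOR-clause-set $F$ is a clause-set $F'$ with $\mathrm{var}(F)\subseteq\mathrm{var}(F')$ such that for each total assignment $\varphi$ of $\mathrm{var}(F)$, $\varphi*F'$ is satisfiable iff $\varphi$ satisfies $F$. It is absolute forcing if (i) for every partial assignment $\varphi$ (over any variables), either $\varphi*F'$ is unsatisfiable and $r_1(\varphi*F')=\{\bot\}$, or it is satisfiable and $r_1(\varphi*F')$ has no forced literals; and (ii) $r_1(\varphi*F')=\top$ for every total $\varphi$ of $\mathrm{var}(F)$ with $\varphi*F'$ satisfiable. *)

theory Defs
  imports Main "HOL-Library.Z2"
begin

datatype 'v lit = Pos 'v | Neg 'v

primrec lit_var :: "'v lit \<Rightarrow> 'v" where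
  "lit_var (Pos v) = v"
| "lit_var (Neg v) = v"

primrec lit_neg :: "'v lit \<Rightarrow> 'v lit" where
  "lit_neg (Pos v) = Neg v"
| "lit_neg (Neg v) = Pos v"

type_synonym 'v clause = "'v lit set"
type_synonym 'v clauses = "'v clause set"

definition is_clause :: "'v clause \<Rightarrow> bool" where
  "is_clause C \<longleftrightarrow> finite C \<and> (\<forall>x\<in>C. lit_neg x \<notin> C)"

definition is_clause_set :: "'v clauses \<Rightarrow> bool" where
  "is_clause_set F \<longleftrightarrow> finite F \<and> (\<forall>C\<in>F. is_clause C)"

definition var_clause :: "'v clause \<Rightarrow> 'v set" where
  "var_clause C = lit_var ` C"

definition var_set :: "'v clauses \<Rightarrow> 'v set" where
  "var_set F = (\<Union>C\<in>F. var_clause C)"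


type_synonym 'v assignment = "'v \<rightharpoonup> bool"

definition partial_assignment :: "'v assignment \<Rightarrow> bool" where
  "partial_assignment \<phi> \<longleftrightarrow> finite (dom \<phi>)"

definition total_for :: "'v assignment \<Rightarrow> 'v set \<Rightarrow> bool" where
  "total_for \<phi> V \<longleftrightarrow> dom \<phi> = V"

primrec lit_true :: "'v assignment \<Rightarrow> 'v lit \<Rightarrow> bool" where
  "lit_true \<phi> (Pos v) \<longleftrightarrow> \<phi> v = Some True"
| "lit_true \<phi> (Neg v) \<longleftrightarrow> \<phi> v = Some False"

definition lit_false :: "'v assignment \<Rightarrow> 'v lit \<Rightarrow> bool" where
  "lit_false \<phi> x \<longleftrightarrow> lit_true \<phi> (lit_neg x)"

primrec assign_lit :: "'v lit \<Rightarrow> bool \<Rightarrow> 'v assignment" where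
  "assign_lit (Pos v) e = [v \<mapsto> e]"
| "assign_lit (Neg v) e = [v \<mapsto> \<not> e]"

definition apply_assignment :: "'v assignment \<Rightarrow> 'v clauses \<Rightarrow> 'v clauses"  (infixr "\<star>" 75) where
  "\<phi> \<star> F = {{x \<in> C. \<not> lit_false \<phi> x} | C. C \<in> F \<and> (\<forall>x\<in>C. \<not> lit_true \<phi> x)}"

definition satisfiable :: "'v clauses \<Rightarrow> bool" where
  "satisfiable F \<longleftrightarrow> (\<exists>\<phi>. partial_assignment \<phi> \<and> \<phi> \<star> F = {})"

definition forced :: "'v lit \<Rightarrow> 'v clauses \<Rightarrow> bool" where
  "forced x F \<longleftrightarrow> \<not> satisfiable (assign_lit x False \<star> F)"


text \<open>Unit-clause propagation is nondeterministic in the choice of the unit clause; the result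
  exists and does not depend on the choices (lemmas \<open>unit_prop_exists\<close> and \<open>unit_prop_unique\<close>).\<close>

inductive unit_prop :: "'v clauses \<Rightarrow> 'v clauses \<Rightarrow> bool" where
  conflict: "{} \<in> F \<Longrightarrow> unit_prop F {{}}"
| stop: "{} \<notin> F \<Longrightarrow> (\<And>x. {x} \<notin> F) \<Longrightarrow> unit_prop F F"
| step: "{} \<notin> F \<Longrightarrow> {x} \<in> F \<Longrightarrow> unit_prop (assign_lit x True \<star> F) G \<Longrightarrow> unit_prop F G"

definition r1 :: "'v clauses \<Rightarrow> 'v clauses" where
  "r1 F = (THE G. unit_prop F G)"

lemma lit_true_assign_lit: "lit_true (assign_lit x True) y \<longleftrightarrow> y = x"
  by (cases x; cases y) auto

lemma lit_false_assign_lit: "lit_false (assign_lit x True) y \<longleftrightarrow> y = lit_neg x"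
  by (cases x; cases y) (auto simp: lit_false_def)

lemma assign_lit_apply: "assign_lit x True \<star> F = {C - {lit_neg x} | C. C \<in> F \<and> x \<notin> C}"
proof -
  have "{y \<in> C. \<not> y = lit_neg x} = C - {lit_neg x}" "(\<forall>y\<in>C. \<not> y = x) \<longleftrightarrow> x \<notin> C" for C
    by auto
  then show ?thesis unfolding apply_assignment_def lit_true_assign_lit lit_false_assign_lit by simp
qed

lemma lit_neg_neg [simp]: "lit_neg (lit_neg x) = x"
  by (cases x) auto

lemma lit_neg_neq [simp]: "lit_neg x \<noteq> x" "x \<noteq> lit_neg x"
  by (cases x; simp)+

lemma lit_var_eq: "lit_var x = lit_var y \<longleftrightarrow> x = y \<or> x = lit_neg y"
  by (cases x; cases y) auto

lemma assign_lit_mem: "E \<in> assign_lit x True \<star> F \<longleftrightarrow> (\<exists>C. C \<in> F \<and> x \<notin> C \<and> E = C - {lit_neg x})"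
  unfolding assign_lit_apply mem_Collect_eq by (rule iffI; elim exE conjE; intro exI conjI)

lemma assign_lit_mem2:
  assumes "x \<noteq> lit_neg y"
  shows "E \<in> assign_lit x True \<star> assign_lit y True \<star> F \<longleftrightarrow>
    (\<exists>C. C \<in> F \<and> x \<notin> C \<and> y \<notin> C \<and> E = C - {lit_neg x} - {lit_neg y})" (is "?L \<longleftrightarrow> ?R")
proof
  assume ?L
  then obtain B where B: "B \<in> assign_lit y True \<star> F" "x \<notin> B" "E = B - {lit_neg x}"
    unfolding assign_lit_mem[of E] by (elim exE conjE)
  then obtain C where C: "C \<in> F" "y \<notin> C" "B = C - {lit_neg y}"
    unfolding assign_lit_mem[of B] by (elim exE conjE)
  have "x \<notin> C" "E = C - {lit_neg x} - {lit_neg y}" using B C assms by auto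
  then show ?R using C by (intro exI[of _ C] conjI)
next
  assume ?R
  then obtain C where C: "C \<in> F" "x \<notin> C" "y \<notin> C" "E = C - {lit_neg x} - {lit_neg y}"
    by (elim exE conjE)
  have "C - {lit_neg y} \<in> assign_lit y True \<star> F"
    unfolding assign_lit_mem using C by (intro exI[of _ C] conjI refl)
  moreover have "x \<notin> C - {lit_neg y}" "E = C - {lit_neg y} - {lit_neg x}" using C by auto
  ultimately show ?L unfolding assign_lit_mem[of E] by (intro exI[of _ "C - {lit_neg y}"] conjI)
qed

lemma assign_lit_commute:
  assumes "y \<noteq> x" "y \<noteq> lit_neg x"
  shows "assign_lit x True \<star> assign_lit y True \<star> F = assign_lit y True \<star> assign_lit x True \<star> F"
proof (rule set_eqI)
  fix E
  have "x \<noteq> lit_neg y" using assms by auto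
  moreover have "C - {lit_neg y} - {lit_neg x} = C - {lit_neg x} - {lit_neg y}" for C by auto
  ultimately show "E \<in> assign_lit x True \<star> assign_lit y True \<star> F \<longleftrightarrow>
      E \<in> assign_lit y True \<star> assign_lit x True \<star> F"
    by (simp only: assign_lit_mem2[OF \<open>x \<noteq> lit_neg y\<close>] assign_lit_mem2[OF assms(2)] conj_left_commute)
qed

lemma empty_in_assign_lit: "{} \<in> assign_lit x True \<star> F \<longleftrightarrow> {} \<in> F \<or> {lit_neg x} \<in> F"
proof -
  have "{} = C - {lit_neg x} \<longleftrightarrow> C = {} \<or> C = {lit_neg x}" for C by auto
  then have "{} \<in> assign_lit x True \<star> F \<longleftrightarrow> (\<exists>C. C \<in> F \<and> x \<notin> C \<and> (C = {} \<or> C = {lit_neg x}))"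
    by (simp only: assign_lit_mem)
  also have "\<dots> \<longleftrightarrow> {} \<in> F \<or> {lit_neg x} \<in> F" by auto
  finally show ?thesis .
qed

lemma unit_in_assign_lit: "{y} \<in> F \<Longrightarrow> y \<noteq> x \<Longrightarrow> y \<noteq> lit_neg x \<Longrightarrow> {y} \<in> assign_lit x True \<star> F"
  unfolding assign_lit_mem by (rule exI[of _ "{y}"]) auto

lemma unit_prop_conflict: "unit_prop F G \<Longrightarrow> {} \<in> F \<Longrightarrow> G = {{}}"
  by (erule unit_prop.cases) auto

lemma unit_prop_step_back: "unit_prop F G \<Longrightarrow> {x} \<in> F \<Longrightarrow> unit_prop (assign_lit x True \<star> F) G"
proof (induction rule: unit_prop.induct)
  case (conflict F)
  then show ?case by (simp add: unit_prop.conflict empty_in_assign_lit)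
next
  case (stop F)
  then show ?case by blast
next
  case (step F y G)
  consider "y = x" | "y = lit_neg x" | "y \<noteq> x" "y \<noteq> lit_neg x" by blast
  then show ?case
  proof cases
    case 1
    then show ?thesis using step by simp
  next
    case 2
    then have "{} \<in> assign_lit x True \<star> F" "{} \<in> assign_lit y True \<star> F"
      using step by (auto simp: empty_in_assign_lit)
    then show ?thesis
      using unit_prop_conflict[OF step.hyps(3)] unit_prop.conflict[of "assign_lit x True \<star> F"] by simp
  next
    case 3
    then have 4: "x \<noteq> y" "x \<noteq> lit_neg y" by auto
    have y: "{y} \<in> assign_lit x True \<star> F" by (rule unit_in_assign_lit[OF step.hyps(2) 3])
    have x: "{x} \<in> assign_lit y True \<star> F" by (rule unit_in_assign_lit[OF step.prems 4])
    have IH: "unit_prop (assign_lit y True \<star> assign_lit x True \<star> F) G"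
      using step.IH[OF x] by (simp only: assign_lit_commute[OF 3])
    show ?thesis
    proof (cases "{} \<in> assign_lit x True \<star> F")
      case True
      then have "{} \<in> assign_lit y True \<star> assign_lit x True \<star> F" by (simp add: empty_in_assign_lit)
      from unit_prop_conflict[OF IH this] show ?thesis
        using unit_prop.conflict[OF True] by simp
    next
      case False
      then show ?thesis by (rule unit_prop.step[OF _ y IH])
    qed
  qed
qed

lemma unit_prop_unique: "unit_prop F G \<Longrightarrow> unit_prop F H \<Longrightarrow> G = H"
proof (induction arbitrary: H rule: unit_prop.induct)
  case (conflict F)
  then show ?case by (blast dest: unit_prop_conflict)
next
  case (stop F)
  from \<open>unit_prop F H\<close> show ?case by cases (use stop in auto)
next
  case (step F x G)
  then show ?case by (blast dest: unit_prop_step_back)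
qed

lemma unit_prop_exists:
  assumes "is_clause_set F"
  shows "\<exists>G. unit_prop F G"
proof -
  have "finite (var_set F)"
    using assms by (auto simp: is_clause_set_def is_clause_def var_set_def var_clause_def)
  then show ?thesis
  proof (induction "card (var_set F)" arbitrary: F rule: less_induct)
    case less
    show ?case
    proof (cases "{} \<notin> F \<and> (\<exists>x. {x} \<in> F)")
      case True
      then obtain x where x: "{x} \<in> F" "{} \<notin> F" by blast
      let ?G = "assign_lit x True \<star> F"
      have "var_set ?G \<subseteq> var_set F - {lit_var x}"
        unfolding assign_lit_apply var_set_def var_clause_def by (auto simp: lit_var_eq)
      moreover have "lit_var x \<in> var_set F"
        using x by (force simp: var_set_def var_clause_def)
      ultimately have "var_set ?G \<subset> var_set F" by blast
      then have "\<exists>H. unit_prop ?G H"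
        using less.hyps[of ?G] less.prems psubset_card_mono finite_subset by blast
      then show ?thesis using unit_prop.step[OF x(2,1)] by blast
    next
      case False
      then show ?thesis by (cases "{} \<in> F") (blast intro: unit_prop.conflict unit_prop.stop)+
    qed
  qed
qed

lemma unit_prop_r1: "is_clause_set F \<Longrightarrow> unit_prop F (r1 F)"
  unfolding r1_def by (rule theI') (blast dest: unit_prop_exists unit_prop_unique)


text \<open>XOR-clauses and XOR-clause-sets are the same syntactic objects as clauses and clause-sets;
  only their semantics differs.\<close>

text \<open>The value is meaningful only if the underlying variable is in the domain.\<close>

primrec lit_val :: "'v assignment \<Rightarrow> 'v lit \<Rightarrow> bit" where
  "lit_val \<phi> (Pos v) = of_bool (the (\<phi> v))"
| "lit_val \<phi> (Neg v) = 1 + of_bool (the (\<phi> v))"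

definition xor_satisfies :: "'v assignment \<Rightarrow> 'v clauses \<Rightarrow> bool" where
  "xor_satisfies \<phi> F \<longleftrightarrow> (\<forall>C\<in>F. (\<Sum>x\<in>C. lit_val \<phi> x) = 0)"

definition xor_models :: "'v clauses \<Rightarrow> 'v assignment set" where
  "xor_models F = {\<phi>. total_for \<phi> (var_set F) \<and> xor_satisfies \<phi> F}"

definition xor_represents :: "'v clauses \<Rightarrow> 'v clauses \<Rightarrow> bool" where
  "xor_represents F' F \<longleftrightarrow> (\<lambda>\<phi>. \<phi> |` var_set F) ` xor_models F' = xor_models F"

definition num_compl :: "'v clause \<Rightarrow> nat" where
  "num_compl C = card {x \<in> C. \<exists>v. x = Neg v}"

definition X0 :: "'v clause \<Rightarrow> 'v clauses" where
  "X0 C = {E. is_clause E \<and> var_clause E = var_clause C \<and> (even (num_compl E) \<longleftrightarrow> odd (num_compl C))}"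

text \<open>The list gives the order \<open>x\<^sub>1, \<dots>, x\<^sub>n\<close> of the literals, so \<open>x\<^sub>i\<close> is \<open>xs ! (i - 1)\<close>;
  \<open>y\<close> supplies the new variables, of which only \<open>y 2, \<dots>, y (n - 1)\<close> are used.\<close>

definition natural_splitting :: "'v lit list \<Rightarrow> (nat \<Rightarrow> 'v) \<Rightarrow> 'v clauses" where
  "natural_splitting xs y =
    (let n = length xs; x = (\<lambda>i. xs ! (i - 1)) in
      if n \<le> 2 then {set xs}
      else {{x 1, x 2, Pos (y 2)}}
         \<union> {{Pos (y (i - 1)), x i, Pos (y i)} | i. 3 \<le> i \<and> i \<le> n - 1}
         \<union> {{Pos (y (n - 1)), x n}})"

text \<open>The choices on which \<open>X1 F\<close> depends: an order of the literals of each XOR-clause, and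
  distinct new variables, disjoint for different XOR-clauses.\<close>

definition splitting_choice ::
  "'v clauses \<Rightarrow> ('v clause \<Rightarrow> 'v lit list) \<Rightarrow> ('v clause \<Rightarrow> nat \<Rightarrow> 'v) \<Rightarrow> bool" where
  "splitting_choice F ord y \<longleftrightarrow>
    (\<forall>C\<in>F. distinct (ord C) \<and> set (ord C) = C) \<and>
    (\<forall>C\<in>F. inj_on (y C) {2..card C - 1} \<and> y C ` {2..card C - 1} \<inter> var_set F = {}) \<and>
    (\<forall>C\<in>F. \<forall>D\<in>F. C \<noteq> D \<longrightarrow> y C ` {2..card C - 1} \<inter> y D ` {2..card D - 1} = {})"

definition X1 ::
  "('v clause \<Rightarrow> 'v lit list) \<Rightarrow> ('v clause \<Rightarrow> nat \<Rightarrow> 'v) \<Rightarrow> 'v clauses \<Rightarrow> 'v clauses" where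
  "X1 ord y F = (\<Union>C\<in>F. \<Union>E\<in>natural_splitting (ord C) (y C). X0 E)"

definition cnf_representation :: "'v clauses \<Rightarrow> 'v clauses \<Rightarrow> bool" where
  "cnf_representation F' F \<longleftrightarrow>
    is_clause_set F' \<and> var_set F \<subseteq> var_set F' \<and>
    (\<forall>\<phi>. total_for \<phi> (var_set F) \<longrightarrow> (satisfiable (\<phi> \<star> F') \<longleftrightarrow> xor_satisfies \<phi> F))"

definition absolute_forcing_representation :: "'v clauses \<Rightarrow> 'v clauses \<Rightarrow> bool" where
  "absolute_forcing_representation F' F \<longleftrightarrow>
    cnf_representation F' F \<and>
    (\<forall>\<phi>. partial_assignment \<phi> \<longrightarrow>
       (\<not> satisfiable (\<phi> \<star> F') \<and> r1 (\<phi> \<star> F') = {{}}) \<or>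
       (satisfiable (\<phi> \<star> F') \<and> (\<forall>x. \<not> forced x (r1 (\<phi> \<star> F'))))) \<and>
    (\<forall>\<phi>. total_for \<phi> (var_set F) \<and> satisfiable (\<phi> \<star> F') \<longrightarrow> r1 (\<phi> \<star> F') = {})"

end

theory Submission
  imports Defs
begin

text \<open>
  After splitting, the XOR-clauses have at most three literals and form a tree in which
  neighbouring subsystems share at most one variable. If unit propagation on their direct
  translations ends without conflict, every XOR-clause is either fully assigned and satisfied, or
  has at least two unassigned variables. By gluing models along the single shared variables, such
  an assignment extends to a model in which any one unassigned variable takes a prescribed value:
  the remaining clause-set is satisfiable and has no forced literal. Moreover, \<open>s\<close> is the sum of
  \<open>I\<close> and the splitting variables are prefix sums; so once the variables of \<open>C\<close> and \<open>D\<close> are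
  assigned, no variable has two possible values, and unit propagation has assigned everything.
\<close>

section \<open>Partial assignments and unit propagation\<close>

lemma lit_true_total_neg: "lit_true (Some \<circ> f) (lit_neg x) \<longleftrightarrow> \<not> lit_true (Some \<circ> f) x"
  by (cases x) auto

lemma lit_true_mono: "\<phi> \<subseteq>\<^sub>m \<psi> \<Longrightarrow> lit_true \<phi> x \<Longrightarrow> lit_true \<psi> x"
  by (cases x) (force simp: map_le_def)+

lemma lit_undef_iff: "\<not> lit_true \<phi> x \<and> \<not> lit_false \<phi> x \<longleftrightarrow> lit_var x \<notin> dom \<phi>"
  by (cases x; cases "\<phi> (lit_var x)") (auto simp: lit_false_def)

lemma map_le_total_iff: "\<phi> \<subseteq>\<^sub>m Some \<circ> f \<longleftrightarrow> (\<forall>v\<in>dom \<phi>. f v = the (\<phi> v))"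
  by (force simp: map_le_def)

text \<open>Total functions take the place of finite partial assignments, so that models can be
  flipped at a variable and glued without tracking domains; \<open>satisfiable_iff\<close>
  translates back.\<close>

definition cnf_models :: "('v \<Rightarrow> bool) \<Rightarrow> 'v clauses \<Rightarrow> bool" where
  "cnf_models f F \<longleftrightarrow> (\<forall>C\<in>F. \<exists>x\<in>C. lit_true (Some \<circ> f) x)"

lemma apply_assignment_empty_iff: "\<phi> \<star> F = {} \<longleftrightarrow> (\<forall>C\<in>F. \<exists>x\<in>C. lit_true \<phi> x)"
  unfolding apply_assignment_def by auto

lemma satisfiable_iff:
  assumes "finite (var_set F)"
  shows "satisfiable F \<longleftrightarrow> (\<exists>f. cnf_models f F)"
proof
  assume "satisfiable F"
  then obtain \<phi> where \<phi>: "\<forall>C\<in>F. \<exists>x\<in>C. lit_true \<phi> x"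
    by (auto simp: satisfiable_def apply_assignment_empty_iff)
  have le: "\<phi> \<subseteq>\<^sub>m Some \<circ> (\<lambda>v. the (\<phi> v))" by (auto simp: map_le_total_iff)
  have "cnf_models (\<lambda>v. the (\<phi> v)) F"
    unfolding cnf_models_def using \<phi> lit_true_mono[OF le] by blast
  then show "\<exists>f. cnf_models f F" by blast
next
  assume "\<exists>f. cnf_models f F"
  then obtain f where f: "cnf_models f F" ..
  \<comment> \<open>Restricting to the variables that occur makes the domain finite, as
    \<open>partial_assignment\<close> demands, and keeps every literal of \<open>F\<close> that is
    true under \<open>f\<close>.\<close>
  let ?\<phi> = "(Some \<circ> f) |` var_set F"
  have "lit_true ?\<phi> x" if "C \<in> F" "x \<in> C" "lit_true (Some \<circ> f) x" for C x
  proof -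
    have "lit_var x \<in> var_set F" using that by (auto simp: var_set_def var_clause_def)
    then show ?thesis using that(3) by (cases x) auto
  qed
  then have "?\<phi> \<star> F = {}"
    using f unfolding apply_assignment_empty_iff cnf_models_def by blast
  moreover have "partial_assignment ?\<phi>" using assms by (simp add: partial_assignment_def)
  ultimately show "satisfiable F" by (auto simp: satisfiable_def)
qed

lemma var_set_apply: "var_set (\<phi> \<star> F) \<subseteq> var_set F - dom \<phi>"
proof
  fix v assume "v \<in> var_set (\<phi> \<star> F)"
  then obtain C x where "C \<in> F" "\<forall>x\<in>C. \<not> lit_true \<phi> x" "x \<in> C" "\<not> lit_false \<phi> x" "v = lit_var x"
    by (auto simp: var_set_def var_clause_def apply_assignment_def)
  then show "v \<in> var_set F - dom \<phi>"
    using lit_undef_iff[of \<phi> x] by (auto simp: var_set_def var_clause_def)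
qed

text \<open>A clause dropped by \<open>\<phi>\<close> is already true under any extension
  \<open>f\<close>, and a literal deleted by \<open>\<phi>\<close> is false under \<open>f\<close>,
  so neither operation changes the verdict.\<close>

lemma cnf_models_apply:
  assumes "\<phi> \<subseteq>\<^sub>m Some \<circ> f"
  shows "cnf_models f (\<phi> \<star> F) \<longleftrightarrow> cnf_models f F"
proof -
  have nf: "\<not> lit_false \<phi> x" if "lit_true (Some \<circ> f) x" for x
    using that lit_true_mono[OF assms, of "lit_neg x"] lit_true_total_neg[of f x]
    unfolding lit_false_def by blast
  have "\<phi> \<star> F = (\<lambda>C. {x \<in> C. \<not> lit_false \<phi> x}) ` {C \<in> F. \<forall>x\<in>C. \<not> lit_true \<phi> x}"
    unfolding apply_assignment_def by (simp only: setcompr_eq_image)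
  then have "cnf_models f (\<phi> \<star> F) \<longleftrightarrow> (\<forall>C\<in>F. (\<forall>x\<in>C. \<not> lit_true \<phi> x) \<longrightarrow>
      (\<exists>x\<in>{x \<in> C. \<not> lit_false \<phi> x}. lit_true (Some \<circ> f) x))"
    by (simp add: cnf_models_def) (simp only: Ball_def imp_conjL)
  also have "\<dots> \<longleftrightarrow> cnf_models f F"
    unfolding cnf_models_def
  proof (rule ball_cong[OF refl])
    fix C
    show "((\<forall>x\<in>C. \<not> lit_true \<phi> x) \<longrightarrow> (\<exists>x\<in>{x \<in> C. \<not> lit_false \<phi> x}. lit_true (Some \<circ> f) x)) =
        (\<exists>x\<in>C. lit_true (Some \<circ> f) x)"
      using nf lit_true_mono[OF assms] by blast
  qed
  finally show ?thesis .
qed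

lemma cnf_models_cong:
  assumes "\<And>v. v \<in> var_set F \<Longrightarrow> f v = g v"
  shows "cnf_models f F \<longleftrightarrow> cnf_models g F"
proof -
  have "lit_true (Some \<circ> f) x = lit_true (Some \<circ> g) x" if "C \<in> F" "x \<in> C" for C x
  proof -
    have "lit_var x \<in> var_set F" using that by (auto simp: var_set_def var_clause_def)
    then show ?thesis using assms by (cases x) auto
  qed
  then show ?thesis unfolding cnf_models_def by blast
qed

lemma satisfiable_apply_iff:
  assumes "finite (var_set F)"
  shows "satisfiable (\<phi> \<star> F) \<longleftrightarrow> (\<exists>f. \<phi> \<subseteq>\<^sub>m Some \<circ> f \<and> cnf_models f F)"
proof -
  have fin: "finite (var_set (\<phi> \<star> F))"
    using finite_subset[OF var_set_apply, of F \<phi>] assms by simp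
  have "\<exists>g. \<phi> \<subseteq>\<^sub>m Some \<circ> g \<and> cnf_models g F" if "cnf_models f (\<phi> \<star> F)" for f
  proof -
    \<comment> \<open>Values on \<open>dom \<phi>\<close> may be overwritten freely, because none of
      these variables occurs in \<open>\<phi> \<star> F\<close>.\<close>
    let ?g = "\<lambda>v. if v \<in> dom \<phi> then the (\<phi> v) else f v"
    have g: "\<phi> \<subseteq>\<^sub>m Some \<circ> ?g" by (auto simp: map_le_total_iff)
    have "cnf_models ?g (\<phi> \<star> F)"
      by (rule iffD2[OF cnf_models_cong that]) (use var_set_apply[of \<phi> F] in auto)
    then show ?thesis using g cnf_models_apply by blast
  qed
  then show ?thesis unfolding satisfiable_iff[OF fin] using cnf_models_apply by blast
qed

text \<open>The side condition ensures that \<open>++\<close> overwrites nothing, so truth under the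
  combined assignment is the disjunction of the two truths.\<close>

lemma apply_assign_lit:
  assumes "lit_var x \<notin> dom \<phi>"
  shows "assign_lit x b \<star> \<phi> \<star> F = (\<phi> ++ assign_lit x b) \<star> F"
proof -
  let ?a = "assign_lit x b"
  have t: "lit_true (\<phi> ++ ?a) z \<longleftrightarrow> lit_true \<phi> z \<or> lit_true ?a z" for z
    using assms by (cases x; cases z) (auto simp: map_add_def split: option.splits)
  then have f: "lit_false (\<phi> ++ ?a) z \<longleftrightarrow> lit_false \<phi> z \<or> lit_false ?a z" for z
    by (simp add: lit_false_def)
  have nf: "\<not> lit_false \<phi> z" if "lit_true ?a z" for z
    using that assms by (cases x; cases z) (auto simp: lit_false_def split: if_splits)
  have "{z \<in> {z \<in> C. \<not> lit_false \<phi> z}. \<not> lit_false ?a z} = {z \<in> C. \<not> lit_false (\<phi> ++ ?a) z}" for C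
    using f by blast
  moreover have "(\<forall>z\<in>C. \<not> lit_true \<phi> z) \<and> (\<forall>z\<in>{z \<in> C. \<not> lit_false \<phi> z}. \<not> lit_true ?a z)
      \<longleftrightarrow> (\<forall>z\<in>C. \<not> lit_true (\<phi> ++ ?a) z)" for C
    using t nf by blast
  moreover have "?a \<star> \<phi> \<star> F = {{z \<in> {z \<in> C. \<not> lit_false \<phi> z}. \<not> lit_false ?a z} | C. C \<in> F \<and>
     ((\<forall>z\<in>C. \<not> lit_true \<phi> z) \<and> (\<forall>z\<in>{z \<in> C. \<not> lit_false \<phi> z}. \<not> lit_true ?a z))}"
    unfolding apply_assignment_def by blast
  ultimately show ?thesis by (simp only: apply_assignment_def)
qed

text \<open>Every clause-set met during propagation has the form \<open>\<psi> \<star> F\<close>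
  with \<open>\<psi>\<close> extending \<open>\<phi>\<close>. Conflicts are reported for the
  original \<open>\<phi>\<close>, because each propagated literal holds in all models of
  \<open>F\<close> that extend the current assignment.\<close>

lemma unit_prop_apply:
  assumes "unit_prop H G" "H = \<phi> \<star> F" "partial_assignment \<phi>"
  shows "(G = {{}} \<and> (\<forall>f. \<phi> \<subseteq>\<^sub>m Some \<circ> f \<longrightarrow> \<not> cnf_models f F)) \<or>
    (\<exists>\<psi>. partial_assignment \<psi> \<and> \<phi> \<subseteq>\<^sub>m \<psi> \<and> G = \<psi> \<star> F \<and> {} \<notin> G \<and> (\<forall>x. {x} \<notin> G))"
  using assms
proof (induction arbitrary: \<phi> rule: unit_prop.induct)
  case (conflict H)
  have "\<not> cnf_models f F" if "\<phi> \<subseteq>\<^sub>m Some \<circ> f" for f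
    using cnf_models_apply[OF that, of F] conflict by (auto simp: cnf_models_def)
  then show ?case by blast
next
  case (stop H)
  then show ?case using map_le_refl by blast
next
  case (step H x G)
  let ?\<psi> = "\<phi> ++ assign_lit x True"
  \<comment> \<open>Only unassigned variables survive in \<open>\<phi> \<star> F\<close>, so
    assigning \<open>x\<close> gives a proper extension of \<open>\<phi>\<close>.\<close>
  have "lit_var x \<in> var_set (\<phi> \<star> F)"
    using step.hyps(2) step.prems by (force simp: var_set_def var_clause_def)
  then have x: "lit_var x \<notin> dom \<phi>" using var_set_apply[of \<phi> F] by blast
  then have le: "\<phi> \<subseteq>\<^sub>m ?\<psi>" by (cases x) (auto simp: map_le_def map_add_def)
  have "partial_assignment ?\<psi>" using step.prems by (cases x) (auto simp: partial_assignment_def)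
  then have IH: "(G = {{}} \<and> (\<forall>f. ?\<psi> \<subseteq>\<^sub>m Some \<circ> f \<longrightarrow> \<not> cnf_models f F)) \<or>
    (\<exists>\<psi>. partial_assignment \<psi> \<and> ?\<psi> \<subseteq>\<^sub>m \<psi> \<and> G = \<psi> \<star> F \<and> {} \<notin> G \<and> (\<forall>x. {x} \<notin> G))"
    using step.IH[of ?\<psi>] step.prems apply_assign_lit[OF x] by blast
  \<comment> \<open>The unit clause makes \<open>x\<close> true in every model of \<open>F\<close>
    that extends \<open>\<phi>\<close>; hence a conflict after the step excludes models of
    \<open>\<phi>\<close> as well.\<close>
  have "?\<psi> \<subseteq>\<^sub>m Some \<circ> f" if "\<phi> \<subseteq>\<^sub>m Some \<circ> f" "cnf_models f F" for f
  proof -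
    have "lit_true (Some \<circ> f) x"
      using iffD2[OF cnf_models_apply[OF that(1)] that(2)] step.hyps(2)
      unfolding step.prems(1) cnf_models_def by blast
    then have "assign_lit x True \<subseteq>\<^sub>m Some \<circ> f" by (cases x) (auto simp: map_le_def)
    then show ?thesis by (rule map_add_le_mapI[OF that(1)])
  qed
  then have *: "\<forall>f. \<phi> \<subseteq>\<^sub>m Some \<circ> f \<longrightarrow> \<not> cnf_models f F"
    if "\<forall>f. ?\<psi> \<subseteq>\<^sub>m Some \<circ> f \<longrightarrow> \<not> cnf_models f F"
    using that by blast
  from IH show ?case
  proof (elim disjE conjE exE)
    fix \<psi>
    assume "?\<psi> \<subseteq>\<^sub>m \<psi>" "partial_assignment \<psi>" "G = \<psi> \<star> F" "{} \<notin> G" "\<forall>x. {x} \<notin> G"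
    moreover from this have "\<phi> \<subseteq>\<^sub>m \<psi>" using le map_le_trans by blast
    ultimately show ?thesis by blast
  qed (use * in blast)
qed

section \<open>The direct translation of an XOR-clause\<close>

text \<open>The unique clause with variable set \<open>V\<close> that is false under
  \<open>f\<close>. Membership of this one clause in \<open>X0 E\<close> decides whether
  \<open>f\<close> violates \<open>E\<close>.\<close>

definition falsified_clause :: "('v \<Rightarrow> bool) \<Rightarrow> 'v set \<Rightarrow> 'v clause" where
  "falsified_clause f V = (\<lambda>v. if f v then Neg v else Pos v) ` V"

lemma var_falsified_clause: "var_clause (falsified_clause f V) = V"
proof -
  have "lit_var (if f v then Neg v else Pos v) = v" for v by simp
  then show ?thesis unfolding var_clause_def falsified_clause_def image_image by simp
qed

lemma is_clause_falsified_clause: "finite V \<Longrightarrow> is_clause (falsified_clause f V)"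
  by (auto simp: is_clause_def falsified_clause_def)

lemma num_compl_falsified_clause: "num_compl (falsified_clause f V) = card {v \<in> V. f v}"
proof -
  have "{x \<in> falsified_clause f V. \<exists>v. x = Neg v} = Neg ` {v \<in> V. f v}"
    by (auto simp: falsified_clause_def split: if_splits)
  then show ?thesis by (simp add: num_compl_def card_image inj_on_def)
qed

lemma not_true_imp_falsified_clause:
  assumes "\<forall>x\<in>B. \<not> lit_true (Some \<circ> f) x"
  shows "B = falsified_clause f (var_clause B)"
proof -
  have "(if f (lit_var x) then Neg (lit_var x) else Pos (lit_var x)) = x" if "x \<in> B" for x
    using that assms by (cases x) auto
  then have "falsified_clause f (var_clause B) = (\<lambda>x. x) ` B"
    unfolding falsified_clause_def var_clause_def image_image by (rule image_cong[OF refl])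
  then show ?thesis by simp
qed

lemma of_nat_bit_eq_0_iff: "(of_nat n :: bit) = 0 \<longleftrightarrow> even n"
  by (induction n) auto

lemma clause_inj_on_var: "is_clause E \<Longrightarrow> inj_on lit_var E"
  by (auto simp: is_clause_def inj_on_def lit_var_eq)

text \<open>A literal contributes 1 for a complement plus the value of its variable. In a clause
  \<open>lit_var\<close> is injective, so summing over literals and over variables is the
  same.\<close>

lemma sum_lit_val:
  assumes "is_clause E"
  shows "(\<Sum>x\<in>E. lit_val (Some \<circ> f) x) = of_nat (num_compl E + card {v \<in> var_clause E. f v})"
proof -
  have fin: "finite E" using assms by (simp add: is_clause_def)
  have "lit_val (Some \<circ> f) x = of_bool (\<exists>v. x = Neg v) + of_bool (f (lit_var x))" for x
    by (cases x) auto
  then have "(\<Sum>x\<in>E. lit_val (Some \<circ> f) x) =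
      (\<Sum>x\<in>E. of_bool (\<exists>v. x = Neg v)) + (\<Sum>x\<in>E. of_bool (f (lit_var x)))"
    by (simp only: sum.distrib)
  also have "(\<Sum>x\<in>E. of_bool (f (lit_var x))) = (\<Sum>v\<in>var_clause E. of_bool (f v) :: bit)"
    unfolding var_clause_def using clause_inj_on_var[OF assms] by (simp add: sum.reindex)
  finally show ?thesis
    using fin by (simp only: sum_of_bool_eq num_compl_def var_clause_def Int_def of_nat_add
        finite_imageI mem_Collect_eq)
qed

text \<open>The falsified clause has one complemented literal per variable that is true under
  \<open>f\<close>. Its parity differs from that of \<open>E\<close> exactly if the total count in
  \<open>sum_lit_val\<close> is odd.\<close>

lemma falsified_clause_in_X0_iff:
  assumes "is_clause E"
  shows "falsified_clause f (var_clause E) \<in> X0 E \<longleftrightarrow> (\<Sum>x\<in>E. lit_val (Some \<circ> f) x) \<noteq> 0"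
proof -
  have "finite (var_clause E)" using assms by (simp add: is_clause_def var_clause_def)
  then show ?thesis
    by (auto simp: X0_def is_clause_falsified_clause var_falsified_clause num_compl_falsified_clause
        sum_lit_val[OF assms] of_nat_bit_eq_0_iff simp del: of_nat_add)
qed

text \<open>All clauses of \<open>X0 E\<close> have the variables of \<open>E\<close>, so the only
  one that \<open>f\<close> can falsify is the falsified clause of \<open>f\<close>.\<close>

lemma cnf_models_X0_iff:
  assumes "is_clause E"
  shows "cnf_models f (X0 E) \<longleftrightarrow> (\<Sum>x\<in>E. lit_val (Some \<circ> f) x) = 0"
proof -
  have "\<not> cnf_models f (X0 E) \<longleftrightarrow> falsified_clause f (var_clause E) \<in> X0 E"
  proof
    assume "\<not> cnf_models f (X0 E)"
    then obtain B where B: "B \<in> X0 E" "\<forall>x\<in>B. \<not> lit_true (Some \<circ> f) x"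
      by (auto simp: cnf_models_def)
    then have "var_clause B = var_clause E" by (simp add: X0_def)
    then show "falsified_clause f (var_clause E) \<in> X0 E"
      using not_true_imp_falsified_clause[OF B(2)] B(1) by simp
  next
    assume "falsified_clause f (var_clause E) \<in> X0 E"
    moreover have "\<not> lit_true (Some \<circ> f) x" if "x \<in> falsified_clause f V" for x V
      using that by (auto simp: falsified_clause_def)
    ultimately show "\<not> cnf_models f (X0 E)" unfolding cnf_models_def by blast
  qed
  then show ?thesis using falsified_clause_in_X0_iff[OF assms, of f] by blast
qed

lemma sum_lit_val_flip:
  assumes "is_clause E" "u \<in> var_clause E"
  shows "(\<Sum>x\<in>E. lit_val (Some \<circ> f(u := \<not> f u)) x) = (\<Sum>x\<in>E. lit_val (Some \<circ> f) x) + 1"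
proof -
  have fin: "finite E" using assms by (simp add: is_clause_def)
  obtain z where z: "z \<in> E" "lit_var z = u" using assms(2) by (auto simp: var_clause_def)
  have other: "lit_val (Some \<circ> f(u := \<not> f u)) x = lit_val (Some \<circ> f) x" if "x \<in> E - {z}" for x
  proof -
    have "lit_var x \<noteq> u" using that z clause_inj_on_var[OF assms(1)] by (auto simp: inj_on_def)
    then show ?thesis by (cases x) auto
  qed
  have "lit_val (Some \<circ> f(u := \<not> f u)) z = lit_val (Some \<circ> f) z + 1"
    using z(2) by (cases z) auto
  moreover have "(\<Sum>x\<in>E - {z}. lit_val (Some \<circ> f(u := \<not> f u)) x) =
      (\<Sum>x\<in>E - {z}. lit_val (Some \<circ> f) x)"
    by (rule sum.cong[OF refl other])
  ultimately show ?thesis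
    by (simp only: sum.remove[OF fin z(1)] add_ac)
qed

lemma sum_lit_val_cong:
  assumes "\<And>v. v \<in> var_clause E \<Longrightarrow> \<phi> v = \<psi> v"
  shows "(\<Sum>x\<in>E. lit_val \<phi> x) = (\<Sum>x\<in>E. lit_val \<psi> x)"
proof (rule sum.cong)
  fix x assume "x \<in> E"
  then have "\<phi> (lit_var x) = \<psi> (lit_var x)" using assms by (simp add: var_clause_def)
  then show "lit_val \<phi> x = lit_val \<psi> x" by (cases x) auto
qed simp

section \<open>Freely extendable XOR-systems\<close>

text \<open>The trace on XOR-clauses of a conflict-free end state of unit propagation. A fully
  assigned XOR-clause has the same sum under all total extensions; quantifying over them keeps the
  later arguments within total functions.\<close>

definition closed_for :: "'v clauses \<Rightarrow> 'v assignment \<Rightarrow> bool" where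
  "closed_for G \<psi> \<longleftrightarrow> (\<forall>E\<in>G.
     (var_clause E \<subseteq> dom \<psi> \<and> (\<forall>f. \<psi> \<subseteq>\<^sub>m Some \<circ> f \<longrightarrow> (\<Sum>x\<in>E. lit_val (Some \<circ> f) x) = 0)) \<or>
     (\<exists>u\<in>var_clause E - dom \<psi>. \<exists>w\<in>var_clause E - dom \<psi>. u \<noteq> w))"

lemma extend_with_parity:
  assumes "is_clause E" "u \<in> var_clause E" "u \<notin> dom \<psi>" "\<psi> \<subseteq>\<^sub>m Some \<circ> f"
  shows "\<exists>g. \<psi> \<subseteq>\<^sub>m Some \<circ> g \<and> (\<forall>v. v \<noteq> u \<longrightarrow> g v = f v) \<and> (\<Sum>x\<in>E. lit_val (Some \<circ> g) x) = c"
proof (cases "(\<Sum>x\<in>E. lit_val (Some \<circ> f) x) = c")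
  case True
  then show ?thesis using assms by blast
next
  case False
  have "(\<Sum>x\<in>E. lit_val (Some \<circ> f(u := \<not> f u)) x) = c"
    unfolding sum_lit_val_flip[OF assms(1,2)] using False
    by (cases "\<Sum>x\<in>E. lit_val (Some \<circ> f) x"; cases c) simp_all
  moreover have "\<psi> \<subseteq>\<^sub>m Some \<circ> f(u := \<not> f u)" using assms(3,4) by (auto simp: map_le_def)
  ultimately show ?thesis by (intro exI[of _ "f(u := \<not> f u)"]) auto
qed

text \<open>A total extension of \<open>\<psi>\<close> that violates \<open>E\<close> falsifies a
  clause of \<open>X0 E\<close>, and what \<open>\<psi>\<close> leaves of this clause is exactly its
  unassigned part. With no unassigned variable this is the empty clause, with one it is a unit
  clause.\<close>

lemma closed_for_if_no_unit:
  assumes G: "\<forall>E\<in>G. is_clause E"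
    and no: "{} \<notin> \<psi> \<star> (\<Union>E\<in>G. X0 E)" "\<And>x. {x} \<notin> \<psi> \<star> (\<Union>E\<in>G. X0 E)"
  shows "closed_for G \<psi>"
  unfolding closed_for_def
proof
  fix E assume E: "E \<in> G"
  then have cl: "is_clause E" using G by blast
  let ?B = "\<lambda>f. falsified_clause f (var_clause E)"
  have res: "{x \<in> ?B f. lit_var x \<notin> dom \<psi>} \<in> \<psi> \<star> (\<Union>E\<in>G. X0 E)"
    if f: "\<psi> \<subseteq>\<^sub>m Some \<circ> f" "(\<Sum>x\<in>E. lit_val (Some \<circ> f) x) \<noteq> 0" for f
  proof -
    have nt: "\<not> lit_true \<psi> x" if "x \<in> ?B f" for x
      using that lit_true_mono[OF f(1), of x] by (auto simp: falsified_clause_def)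
    then have "{x \<in> ?B f. lit_var x \<notin> dom \<psi>} = {x \<in> ?B f. \<not> lit_false \<psi> x}"
      using lit_undef_iff[of \<psi>] by blast
    moreover have "?B f \<in> (\<Union>E\<in>G. X0 E)"
      using E falsified_clause_in_X0_iff[OF cl] f(2) by blast
    ultimately show ?thesis using nt unfolding apply_assignment_def by blast
  qed
  consider (all) "var_clause E \<subseteq> dom \<psi>" | (one) u where "var_clause E - dom \<psi> = {u}"
    | (two) "\<exists>u\<in>var_clause E - dom \<psi>. \<exists>w\<in>var_clause E - dom \<psi>. u \<noteq> w" by blast
  then show "(var_clause E \<subseteq> dom \<psi> \<and>
       (\<forall>f. \<psi> \<subseteq>\<^sub>m Some \<circ> f \<longrightarrow> (\<Sum>x\<in>E. lit_val (Some \<circ> f) x) = 0)) \<or>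
     (\<exists>u\<in>var_clause E - dom \<psi>. \<exists>w\<in>var_clause E - dom \<psi>. u \<noteq> w)"
  proof cases
    case all
    then have "{x \<in> ?B f. lit_var x \<notin> dom \<psi>} = {}" for f
      by (auto simp: falsified_clause_def)
    then have "(\<Sum>x\<in>E. lit_val (Some \<circ> f) x) = 0" if "\<psi> \<subseteq>\<^sub>m Some \<circ> f" for f
      using res[OF that] no(1) by metis
    then show ?thesis using all by blast
  next
    case one
    \<comment> \<open>The single free variable \<open>u\<close> is used to obtain an extension that
      violates \<open>E\<close>; its falsified clause leaves only the literal on
      \<open>u\<close>.\<close>
    have "\<psi> \<subseteq>\<^sub>m Some \<circ> (\<lambda>v. the (\<psi> v))" by (auto simp: map_le_total_iff)
    then obtain g where g: "\<psi> \<subseteq>\<^sub>m Some \<circ> g" "(\<Sum>x\<in>E. lit_val (Some \<circ> g) x) = 1"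
      using extend_with_parity[OF cl, of u \<psi> _ 1] one by blast
    have "{x \<in> ?B g. lit_var x \<notin> dom \<psi>} = {if g u then Neg u else Pos u}"
    proof -
      have "{x \<in> ?B g. lit_var x \<notin> dom \<psi>} =
          (\<lambda>v. if g v then Neg v else Pos v) ` (var_clause E - dom \<psi>)"
        unfolding falsified_clause_def by (auto simp del: domIff)
      then show ?thesis by (simp add: one)
    qed
    then show ?thesis using res[OF g(1)] g(2) no(2) by simp
  next
    case two
    then show ?thesis ..
  qed
qed

text \<open>The condition on \<open>\<psi> v\<close> covers a free \<open>v\<close> as well as one
  that already has the value \<open>b\<close>. In this uniform form the value of a shared variable
  can be prescribed whether or not it is assigned.\<close>

definition freely_extendable :: "'v clauses \<Rightarrow> bool" where
  "freely_extendable G \<longleftrightarrow> (\<forall>\<psi> v b. closed_for G \<psi> \<longrightarrow> \<psi> v \<in> {None, Some b} \<longrightarrow>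
     (\<exists>f. \<psi> \<subseteq>\<^sub>m Some \<circ> f \<and> f v = b \<and> xor_satisfies (Some \<circ> f) G))"

lemma freely_extendable_singleton:
  assumes "is_clause E"
  shows "freely_extendable {E}"
  unfolding freely_extendable_def
proof (intro allI impI)
  fix \<psi> v b
  assume cl: "closed_for {E} \<psi>" and v: "\<psi> v \<in> {None, Some b}"
  let ?f = "(\<lambda>w. the (\<psi> w))(v := b)"
  have f: "\<psi> \<subseteq>\<^sub>m Some \<circ> ?f" using v by (auto simp: map_le_total_iff)
  show "\<exists>f. \<psi> \<subseteq>\<^sub>m Some \<circ> f \<and> f v = b \<and> xor_satisfies (Some \<circ> f) {E}"
  proof (cases "(\<Sum>x\<in>E. lit_val (Some \<circ> ?f) x) = 0")
    case True
    then have "xor_satisfies (Some \<circ> ?f) {E}" unfolding xor_satisfies_def by blast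
    then show ?thesis using f by (intro exI[of _ ?f]) auto
  next
    case False
    \<comment> \<open>\<open>?f\<close> extends \<open>\<psi>\<close> and violates \<open>E\<close>,
      which leaves only the second alternative of \<open>closed_for\<close>. Of two distinct free
      variables at least one differs from \<open>v\<close> and can repair the parity.\<close>
    then have "\<exists>u\<in>var_clause E - dom \<psi>. \<exists>w\<in>var_clause E - dom \<psi>. u \<noteq> w"
      using cl f unfolding closed_for_def by (simp only: singleton_iff ball_simps) blast
    then obtain u where u: "u \<in> var_clause E" "u \<notin> dom \<psi>" "u \<noteq> v" by blast
    obtain g where g: "\<psi> \<subseteq>\<^sub>m Some \<circ> g" "\<forall>v. v \<noteq> u \<longrightarrow> g v = ?f v"
        "(\<Sum>x\<in>E. lit_val (Some \<circ> g) x) = 0"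
      using extend_with_parity[OF assms u(1,2) f] by blast
    have "g v = b" using g(2) u(3) by simp
    then show ?thesis using g(1,3) by (auto simp: xor_satisfies_def)
  qed
qed

section \<open>Gluing two systems along one shared variable\<close>

lemma xor_satisfies_cong:
  assumes "\<And>v. v \<in> var_set G \<Longrightarrow> \<phi> v = \<psi> v"
  shows "xor_satisfies \<phi> G \<longleftrightarrow> xor_satisfies \<psi> G"
proof -
  have "(\<Sum>x\<in>E. lit_val \<phi> x) = (\<Sum>x\<in>E. lit_val \<psi> x)" if "E \<in> G" for E
    by (rule sum_lit_val_cong) (use that assms in \<open>auto simp: var_set_def\<close>)
  then show ?thesis by (simp add: xor_satisfies_def)
qed

lemma xor_satisfies_Un: "xor_satisfies \<phi> (G \<union> H) \<longleftrightarrow> xor_satisfies \<phi> G \<and> xor_satisfies \<phi> H"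
  by (auto simp: xor_satisfies_def)

lemma closed_for_Un: "closed_for (G \<union> H) \<psi> \<longleftrightarrow> closed_for G \<psi> \<and> closed_for H \<psi>"
  unfolding closed_for_def by blast

lemma var_set_Un: "var_set (G \<union> H) = var_set G \<union> var_set H"
  by (auto simp: var_set_def)

text \<open>A model of G is chosen first, prescribing v; a model of H is then chosen to agree with it at
  the only shared variable.\<close>

lemma freely_extendable_Un_aux:
  assumes G: "freely_extendable G" and H: "freely_extendable H"
    and sub: "var_set G \<inter> var_set H \<subseteq> {w}"
    and cl: "closed_for G \<psi>" "closed_for H \<psi>"
    and v: "\<psi> v \<in> {None, Some b}" "v \<in> var_set G \<or> v \<notin> var_set H"
  shows "\<exists>f. \<psi> \<subseteq>\<^sub>m Some \<circ> f \<and> f v = b \<and> xor_satisfies (Some \<circ> f) (G \<union> H)"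
proof -
  obtain f where f: "\<psi> \<subseteq>\<^sub>m Some \<circ> f" "f v = b" "xor_satisfies (Some \<circ> f) G"
    using G cl(1) v(1) unfolding freely_extendable_def by blast
  \<comment> \<open>Because \<open>f\<close> extends \<open>\<psi>\<close>, the value
    \<open>f w\<close> is an admissible request to \<open>H\<close>.\<close>
  have "\<psi> w \<in> {None, Some (f w)}" using f(1) by (cases "\<psi> w") (force simp: map_le_def)+
  then obtain g where g: "\<psi> \<subseteq>\<^sub>m Some \<circ> g" "g w = f w" "xor_satisfies (Some \<circ> g) H"
    using H cl(2) unfolding freely_extendable_def by blast
  \<comment> \<open>\<open>f\<close> has priority except at variables occurring only in
    \<open>H\<close>, which preserves the value at \<open>v\<close>. On \<open>var_set H\<close> the
    function still equals \<open>g\<close>, since the only possible overlap \<open>w\<close>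
    satisfies \<open>g w = f w\<close>.\<close>
  let ?h = "\<lambda>u. if u \<in> var_set H - var_set G then g u else f u"
  have "\<psi> \<subseteq>\<^sub>m Some \<circ> ?h" using f(1) g(1) by (simp add: map_le_total_iff)
  moreover have "?h v = b" using v f(2) by auto
  moreover have "xor_satisfies (Some \<circ> ?h) G"
    using f(3) xor_satisfies_cong[of G "Some \<circ> ?h" "Some \<circ> f"] by simp
  moreover have "xor_satisfies (Some \<circ> ?h) H"
  proof -
    have "?h u = g u" if "u \<in> var_set H" for u
      using that sub g(2) by auto
    then show ?thesis using g(3) xor_satisfies_cong[of H "Some \<circ> ?h" "Some \<circ> g"] by simp
  qed
  ultimately show ?thesis unfolding xor_satisfies_Un by blast
qed

lemma freely_extendable_Un:
  assumes G: "freely_extendable G" and H: "freely_extendable H"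
    and sub: "var_set G \<inter> var_set H \<subseteq> {w}"
  shows "freely_extendable (G \<union> H)"
  unfolding freely_extendable_def
proof (intro allI impI)
  fix \<psi> v b
  assume cl: "closed_for (G \<union> H) \<psi>" and v: "\<psi> v \<in> {None, Some b}"
  have cls: "closed_for G \<psi>" "closed_for H \<psi>" using cl by (simp_all add: closed_for_Un)
  show "\<exists>f. \<psi> \<subseteq>\<^sub>m Some \<circ> f \<and> f v = b \<and> xor_satisfies (Some \<circ> f) (G \<union> H)"
  proof (cases "v \<in> var_set G \<or> v \<notin> var_set H")
    case True
    then show ?thesis using freely_extendable_Un_aux[OF G H sub cls v] by blast
  next
    \<comment> \<open>Here \<open>v\<close> occurs only in \<open>H\<close>, so the roles are
      exchanged and the model of \<open>H\<close> is chosen first.\<close>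
    case False
    moreover have "var_set H \<inter> var_set G \<subseteq> {w}" using sub by blast
    ultimately show ?thesis
      using freely_extendable_Un_aux[OF H G _ cls(2,1) v] by (simp add: Un_commute)
  qed
qed

section \<open>The natural splitting of one XOR-clause\<close>

lemma is_clause_two: "lit_var a \<noteq> lit_var b \<Longrightarrow> is_clause {a, b}"
  by (auto simp: is_clause_def lit_var_eq)

lemma is_clause_three:
  "lit_var a \<noteq> lit_var b \<Longrightarrow> lit_var a \<noteq> lit_var c \<Longrightarrow> lit_var b \<noteq> lit_var c \<Longrightarrow> is_clause {a, b, c}"
  by (auto simp: is_clause_def lit_var_eq)

lemma bit_add_eq_0_iff: "a + b = 0 \<longleftrightarrow> a = b" for a b :: bit
  by (cases a; cases b) simp_all

lemma lit_val_Pos_eq_iff: "lit_val (Some \<circ> f) (Pos v) = b \<longleftrightarrow> f v = (b = 1)"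
  by (cases b) auto

lemma var_set_insert: "var_set (insert E G) = var_clause E \<union> var_set G"
  by (simp add: var_set_def)

lemma var_set_empty: "var_set {} = {}"
  by (simp add: var_set_def)

text \<open>The natural splitting without its closing binary clause, cut off at the new variable
  \<open>y k\<close>; this truncation is what makes induction on \<open>k\<close> possible.\<close>

definition splitting_chain :: "'v lit list \<Rightarrow> (nat \<Rightarrow> 'v) \<Rightarrow> nat \<Rightarrow> 'v clauses" where
  "splitting_chain xs y k = insert {xs ! 0, xs ! 1, Pos (y 2)}
     ((\<lambda>i. {Pos (y (i - 1)), xs ! (i - 1), Pos (y i)}) ` {3..k})"

lemma splitting_chain_2: "splitting_chain xs y 2 = {{xs ! 0, xs ! 1, Pos (y 2)}}"
  by (simp add: splitting_chain_def)

lemma splitting_chain_Suc: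
  assumes "2 \<le> k"
  shows "splitting_chain xs y (Suc k) = splitting_chain xs y k \<union> {{Pos (y k), xs ! k, Pos (y (Suc k))}}"
proof -
  have "{3..Suc k} = insert (Suc k) {3..k}" using assms by auto
  then show ?thesis by (simp add: splitting_chain_def insert_commute)
qed

lemma natural_splitting_chain:
  assumes "3 \<le> length xs"
  shows "natural_splitting xs y = splitting_chain xs y (length xs - 1) \<union>
    {{Pos (y (length xs - 1)), xs ! (length xs - 1)}}"
proof -
  have "{{Pos (y (i - 1)), xs ! (i - 1), Pos (y i)} | i. 3 \<le> i \<and> i \<le> length xs - 1} =
      (\<lambda>i. {Pos (y (i - 1)), xs ! (i - 1), Pos (y i)}) ` {3..length xs - 1}" by auto
  then show ?thesis
    using assms unfolding natural_splitting_def splitting_chain_def Let_def by simp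
qed

locale splitting =
  fixes xs :: "'v lit list" and y :: "nat \<Rightarrow> 'v"
  assumes dist: "distinct xs" and clause: "is_clause (set xs)"
    and inj: "inj_on y {2..length xs - 1}"
    and fresh: "y ` {2..length xs - 1} \<inter> var_clause (set xs) = {}"
begin

lemma lit_var_nth_neq:
  assumes "i < length xs" "j < length xs" "i \<noteq> j"
  shows "lit_var (xs ! i) \<noteq> lit_var (xs ! j)"
  using assms nth_eq_iff_index_eq[OF dist] inj_onD[OF clause_inj_on_var[OF clause], of "xs ! i" "xs ! j"]
  by auto

lemma y_neq_lit_var:
  assumes "2 \<le> i" "i < length xs" "j < length xs"
  shows "y i \<noteq> lit_var (xs ! j)" "lit_var (xs ! j) \<noteq> y i"
  using assms fresh by (force simp: var_clause_def)+

lemma Pos_y_neq_nth: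
  assumes "2 \<le> i" "i < length xs" "j < length xs"
  shows "Pos (y i) \<noteq> xs ! j" "xs ! j \<noteq> Pos (y i)"
  using y_neq_lit_var[OF assms] lit_var.simps(1)[of "y i"] by metis+

lemma y_neq:
  assumes "2 \<le> i" "i < length xs" "2 \<le> j" "j < length xs" "i \<noteq> j"
  shows "y i \<noteq> y j"
proof -
  have "i \<in> {2..length xs - 1}" "j \<in> {2..length xs - 1}" using assms by auto
  then show ?thesis using inj_onD[OF inj] assms(5) by blast
qed

lemma is_clause_first:
  assumes "2 < length xs"
  shows "is_clause {xs ! 0, xs ! 1, Pos (y 2)}"
proof -
  have "0 < length xs" "1 < length xs" using assms by linarith+
  then show ?thesis
    by (intro is_clause_three) (simp_all only: lit_var.simps lit_var_nth_neq y_neq_lit_var assms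
        zero_neq_one order.refl not_False_eq_True)
qed

lemma is_clause_step:
  assumes "2 \<le> k" "Suc k < length xs"
  shows "is_clause {Pos (y k), xs ! k, Pos (y (Suc k))}"
  using assms by (intro is_clause_three) (simp_all add: y_neq y_neq_lit_var)

lemma is_clause_last:
  assumes "3 \<le> length xs"
  shows "is_clause {Pos (y (length xs - 1)), xs ! (length xs - 1)}"
  using assms by (intro is_clause_two) (simp_all add: y_neq_lit_var)

section \<open>Chains: variables, gluing and models\<close>

lemma splitting_chain_clauses:
  assumes "2 \<le> k" "k < length xs"
  shows "\<forall>E\<in>splitting_chain xs y k. is_clause E"
  using assms
proof (induction k rule: dec_induct)
  case base
  then show ?case by (simp add: splitting_chain_2 is_clause_first del: One_nat_def)
next
  case (step k)
  then show ?case by (simp add: splitting_chain_Suc is_clause_step)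
qed

lemma var_set_splitting_chain:
  assumes "2 \<le> k" "k < length xs"
  shows "var_set (splitting_chain xs y k) = (\<lambda>i. lit_var (xs ! i)) ` {..<k} \<union> y ` {2..k}"
  using assms
proof (induction k rule: dec_induct)
  case base
  have "{..<2} = {0, 1::nat}" by auto
  then show ?case by (auto simp: splitting_chain_2 var_set_insert var_set_empty var_clause_def)
next
  case (step k)
  have "{2..Suc k} = insert (Suc k) {2..k}" "k \<in> {2..k}" using step.hyps by auto
  then show ?case
    using step by (auto simp: splitting_chain_Suc var_set_Un var_set_insert var_set_empty
        var_clause_def lessThan_Suc)
qed

text \<open>The next clause has a fresh literal and a fresh new variable, so it meets the preceding
  chain only in \<open>y k\<close> and can be glued there.\<close>

lemma freely_extendable_splitting_chain:
  assumes "2 \<le> k" "k < length xs"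
  shows "freely_extendable (splitting_chain xs y k)"
  using assms
proof (induction k rule: dec_induct)
  case base
  then show ?case
    unfolding splitting_chain_2 by (intro freely_extendable_singleton is_clause_first) simp
next
  case (step k)
  have "var_set (splitting_chain xs y k) \<inter> var_set {{Pos (y k), xs ! k, Pos (y (Suc k))}} \<subseteq> {y k}"
    using step.prems step.hyps
    by (auto simp: var_set_splitting_chain var_set_insert var_set_empty var_clause_def
        y_neq_lit_var y_neq lit_var_nth_neq)
  then show ?case
    using step unfolding splitting_chain_Suc[OF step.hyps(1)]
    by (intro freely_extendable_Un[where w = "y k"] freely_extendable_singleton is_clause_step) simp_all
qed

text \<open>Over \<open>bit\<close> a sum vanishes iff its two parts are equal, so each clause can
  be read as a definition of its last new variable: it adds one literal to the sum carried by the
  preceding one.\<close>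

lemma xor_satisfies_splitting_chain:
  assumes "2 \<le> k" "k < length xs"
  shows "xor_satisfies (Some \<circ> f) (splitting_chain xs y k) \<longleftrightarrow>
    (\<forall>i\<in>{2..k}. lit_val (Some \<circ> f) (Pos (y i)) = (\<Sum>j<i. lit_val (Some \<circ> f) (xs ! j)))"
  using assms
proof (induction k rule: dec_induct)
  case base
  let ?v = "lit_val (Some \<circ> f)"
  have ne: "xs ! 0 \<noteq> xs ! 1" "xs ! 0 \<noteq> Pos (y 2)" "xs ! 1 \<noteq> Pos (y 2)"
  proof -
    have *: "0 < length xs" "1 < length xs" using base by linarith+
    then show "xs ! 0 \<noteq> xs ! 1" using lit_var_nth_neq[of 0 1] by force
    show "xs ! 0 \<noteq> Pos (y 2)" "xs ! 1 \<noteq> Pos (y 2)"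
      using Pos_y_neq_nth(2)[OF order.refl base] * by blast+
  qed
  then have sum: "(\<Sum>x\<in>{xs ! 0, xs ! 1, Pos (y 2)}. ?v x) = ?v (Pos (y 2)) + (?v (xs ! 0) + ?v (xs ! 1))"
    by (simp only: sum.insert finite.intros insert_iff empty_iff sum.empty simp_thms add_ac add_0_right add_0)
  have "(\<Sum>j<2. ?v (xs ! j)) = ?v (xs ! 0) + ?v (xs ! 1)"
    by (simp only: numeral_2_eq_2 sum.lessThan_Suc lessThan_0 sum.empty One_nat_def add_0)
  moreover have "{2..2} = {2::nat}" by auto
  ultimately show ?case
    unfolding splitting_chain_2 xor_satisfies_def
    by (simp only: ball_simps singleton_iff sum bit_add_eq_0_iff simp_thms)
next
  case (step k)
  let ?v = "lit_val (Some \<circ> f)"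
  have ne: "Pos (y k) \<noteq> xs ! k" "Pos (y k) \<noteq> Pos (y (Suc k))" "xs ! k \<noteq> Pos (y (Suc k))"
    using step by (simp_all add: Pos_y_neq_nth y_neq)
  then have sum: "(\<Sum>x\<in>{Pos (y k), xs ! k, Pos (y (Suc k))}. ?v x) =
      ?v (Pos (y (Suc k))) + (?v (Pos (y k)) + ?v (xs ! k))"
    by (simp only: sum.insert finite.intros insert_iff empty_iff sum.empty simp_thms add_ac add_0_right add_0)
  have I: "{2..Suc k} = insert (Suc k) {2..k}" and k: "k \<in> {2..k}" using step.hyps by auto
  have "xor_satisfies (Some \<circ> f) (splitting_chain xs y (Suc k)) \<longleftrightarrow>
      (\<forall>i\<in>{2..k}. ?v (Pos (y i)) = (\<Sum>j<i. ?v (xs ! j))) \<and>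
      ?v (Pos (y (Suc k))) = ?v (Pos (y k)) + ?v (xs ! k)"
    unfolding splitting_chain_Suc[OF step.hyps(1)] xor_satisfies_Un
    using step.IH step.prems
    by (simp only: xor_satisfies_def ball_simps sum bit_add_eq_0_iff simp_thms Suc_lessD)
  \<comment> \<open>The equation for index \<open>k\<close> turns the value of \<open>y k\<close>
    into a prefix sum, which the literal \<open>xs ! k\<close> then prolongs.\<close>
  also have "\<dots> \<longleftrightarrow> (\<forall>i\<in>{2..Suc k}. ?v (Pos (y i)) = (\<Sum>j<i. ?v (xs ! j)))"
    unfolding I sum.lessThan_Suc ball_simps using k by metis
  finally show ?case .
qed

section \<open>From chains to the whole natural splitting\<close>

lemma natural_splitting_clauses: "\<forall>E\<in>natural_splitting xs y. is_clause E"
proof (cases "3 \<le> length xs")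
  case True
  then show ?thesis
    using splitting_chain_clauses[of "length xs - 1"] is_clause_last
    by (auto simp: natural_splitting_chain)
qed (simp add: natural_splitting_def clause)

lemma var_set_natural_splitting:
  "var_set (natural_splitting xs y) = var_clause (set xs) \<union> y ` {2..length xs - 1}"
proof (cases "3 \<le> length xs")
  case True
  then obtain m where m: "length xs = Suc m" "2 \<le> m" by (cases "length xs") auto
  have "set xs = (!) xs ` {..<Suc m}" using m by (auto simp: set_conv_nth)
  then have "var_clause (set xs) = (\<lambda>i. lit_var (xs ! i)) ` {..<Suc m}"
    by (simp only: var_clause_def image_image)
  moreover have "m \<in> {2..m}" using m by simp
  ultimately show ?thesis
    using m by (auto simp: natural_splitting_chain var_set_splitting_chain var_set_Un var_set_insert
        var_set_empty var_clause_def lessThan_Suc)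
qed (auto simp: natural_splitting_def var_set_insert var_set_empty)

lemma freely_extendable_natural_splitting: "freely_extendable (natural_splitting xs y)"
proof (cases "3 \<le> length xs")
  case True
  let ?m = "length xs - 1"
  have "var_set (splitting_chain xs y ?m) \<inter> var_set {{Pos (y ?m), xs ! ?m}} \<subseteq> {y ?m}"
    using True
    by (auto simp: var_set_splitting_chain var_set_insert var_set_empty var_clause_def
        y_neq_lit_var lit_var_nth_neq)
  then show ?thesis
    unfolding natural_splitting_chain[OF True] using True
    by (intro freely_extendable_Un[where w = "y ?m"] freely_extendable_singleton is_clause_last
        freely_extendable_splitting_chain) simp_all
qed (simp add: natural_splitting_def freely_extendable_singleton clause)

text \<open>Given the prefix sums, the closing clause adds the last literal to the sum of all
  others, so it says that the original XOR-clause holds. For at most two literals the index range is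
  empty.\<close>

lemma xor_satisfies_natural_splitting:
  "xor_satisfies (Some \<circ> f) (natural_splitting xs y) \<longleftrightarrow> xor_satisfies (Some \<circ> f) {set xs} \<and>
    (\<forall>i\<in>{2..length xs - 1}. lit_val (Some \<circ> f) (Pos (y i)) = (\<Sum>j<i. lit_val (Some \<circ> f) (xs ! j)))"
proof (cases "3 \<le> length xs")
  case True
  then obtain m where m: "length xs = Suc m" "2 \<le> m" by (cases "length xs") auto
  let ?v = "lit_val (Some \<circ> f)"
  have "(\<Sum>x\<in>set xs. ?v x) = (\<Sum>j<Suc m. ?v (xs ! j))"
    using sum.reindex_bij_betw[OF bij_betw_nth[OF dist refl refl], of ?v] m by simp
  then have total: "(\<Sum>x\<in>set xs. ?v x) = (\<Sum>j<m. ?v (xs ! j)) + ?v (xs ! m)"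
    by (simp only: sum.lessThan_Suc)
  have "Pos (y m) \<noteq> xs ! m" using m by (simp add: Pos_y_neq_nth)
  then have last: "(\<Sum>x\<in>{Pos (y m), xs ! m}. ?v x) = ?v (Pos (y m)) + ?v (xs ! m)"
    by (simp only: sum.insert finite.intros insert_iff empty_iff sum.empty simp_thms add_0_right)
  have "m \<in> {2..m}" using m by simp
  then show ?thesis
    unfolding natural_splitting_chain[OF True] xor_satisfies_Un m(1) diff_Suc_1
    using xor_satisfies_splitting_chain[of m f] m
    by (simp only: xor_satisfies_def ball_simps last total simp_thms lessI) metis
qed (simp add: natural_splitting_def)

end

section \<open>Absolute forcing for freely extendable systems\<close>

lemma cnf_models_Union_X0_iff:
  assumes "\<forall>E\<in>G. is_clause E"
  shows "cnf_models f (\<Union>E\<in>G. X0 E) \<longleftrightarrow> xor_satisfies (Some \<circ> f) G"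
proof -
  have "cnf_models f (\<Union>E\<in>G. X0 E) \<longleftrightarrow> (\<forall>E\<in>G. cnf_models f (X0 E))"
    unfolding cnf_models_def by (simp only: ball_UN)
  then show ?thesis using assms unfolding xor_satisfies_def by (simp add: cnf_models_X0_iff)
qed

lemma finite_X0:
  assumes "is_clause E"
  shows "finite (X0 E)"
proof -
  have "x \<in> Pos ` var_clause E \<union> Neg ` var_clause E" if "x \<in> B" "B \<in> X0 E" for x B
  proof -
    have "lit_var x \<in> var_clause E" using that by (auto simp: X0_def var_clause_def)
    then show ?thesis by (cases x) auto
  qed
  then have "X0 E \<subseteq> Pow (Pos ` var_clause E \<union> Neg ` var_clause E)" by blast
  moreover have "finite (var_clause E)" using assms by (simp add: is_clause_def var_clause_def)
  ultimately show ?thesis by (simp add: finite_subset)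
qed

lemma is_clause_set_Union_X0:
  assumes "finite G" "\<forall>E\<in>G. is_clause E"
  shows "is_clause_set (\<Union>E\<in>G. X0 E)"
  using assms finite_X0 by (auto simp: is_clause_set_def X0_def)

text \<open>If \<open>E\<close> has a variable, some total function violates \<open>E\<close>; the
  clause falsified by it lies in \<open>X0 E\<close> and mentions every variable of
  \<open>E\<close>.\<close>

lemma var_set_X0:
  assumes "is_clause E"
  shows "var_set (X0 E) = var_clause E"
proof
  show "var_set (X0 E) \<subseteq> var_clause E" by (auto simp: var_set_def X0_def)
  show "var_clause E \<subseteq> var_set (X0 E)"
  proof
    fix v assume v: "v \<in> var_clause E"
    obtain f where "(\<Sum>x\<in>E. lit_val (Some \<circ> f) x) = 1"
      using extend_with_parity[OF assms v, of Map.empty "\<lambda>_. False" 1] by auto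
    then have "falsified_clause f (var_clause E) \<in> X0 E"
      by (simp add: falsified_clause_in_X0_iff[OF assms])
    then show "v \<in> var_set (X0 E)"
      using v var_falsified_clause[of f "var_clause E"] unfolding var_set_def by blast
  qed
qed

lemma var_set_Union_X0:
  assumes "\<forall>E\<in>G. is_clause E"
  shows "var_set (\<Union>E\<in>G. X0 E) = var_set G"
proof -
  have "var_set (\<Union>E\<in>G. X0 E) = (\<Union>E\<in>G. var_set (X0 E))" by (simp add: var_set_def)
  also have "\<dots> = (\<Union>E\<in>G. var_clause E)" using assms by (simp add: var_set_X0)
  finally show ?thesis by (simp add: var_set_def)
qed

lemma is_clause_set_apply:
  assumes "is_clause_set F"
  shows "is_clause_set (\<phi> \<star> F)"
proof -
  have "\<phi> \<star> F = (\<lambda>C. {x \<in> C. \<not> lit_false \<phi> x}) ` {C \<in> F. \<forall>x\<in>C. \<not> lit_true \<phi> x}"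
    unfolding apply_assignment_def by (simp only: setcompr_eq_image)
  then show ?thesis using assms by (auto simp: is_clause_set_def is_clause_def)
qed

lemma finite_var_set: "is_clause_set F \<Longrightarrow> finite (var_set F)"
  by (auto simp: is_clause_set_def is_clause_def var_set_def var_clause_def)

section \<open>Outcomes of unit propagation on a freely extendable system\<close>

locale free_xor_system =
  fixes G :: "'v clauses"
  assumes finite_system: "finite G" and clauses: "\<forall>E\<in>G. is_clause E"
    and free: "freely_extendable G"
begin

abbreviation F where "F \<equiv> \<Union>E\<in>G. X0 E"

lemmas clause_set = is_clause_set_Union_X0[OF finite_system clauses]

lemma satisfiable_apply_xor_iff:
  "satisfiable (\<phi> \<star> F) \<longleftrightarrow> (\<exists>f. \<phi> \<subseteq>\<^sub>m Some \<circ> f \<and> xor_satisfies (Some \<circ> f) G)"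
  unfolding satisfiable_apply_iff[OF finite_var_set[OF clause_set]]
    cnf_models_Union_X0_iff[OF clauses] ..

text \<open>Reduces the later arguments about \<open>r1\<close> to two outcomes: a genuine
  contradiction, or a closed extension to which free extendability applies.\<close>

lemma r1_cases:
  assumes "partial_assignment \<phi>"
  obtains (conflict) "r1 (\<phi> \<star> F) = {{}}" "\<not> satisfiable (\<phi> \<star> F)"
  | (closed) \<psi> where "\<phi> \<subseteq>\<^sub>m \<psi>" "r1 (\<phi> \<star> F) = \<psi> \<star> F" "closed_for G \<psi>"
proof -
  have "unit_prop (\<phi> \<star> F) (r1 (\<phi> \<star> F))"
    by (rule unit_prop_r1[OF is_clause_set_apply[OF clause_set]])
  from unit_prop_apply[OF this refl assms] show thesis
  proof (elim disjE conjE exE)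
    assume "r1 (\<phi> \<star> F) = {{}}" "\<forall>f. \<phi> \<subseteq>\<^sub>m Some \<circ> f \<longrightarrow> \<not> cnf_models f F"
    then show thesis
      using conflict satisfiable_apply_iff[OF finite_var_set[OF clause_set]] by blast
  next
    fix \<psi>
    assume "\<phi> \<subseteq>\<^sub>m \<psi>" and r: "r1 (\<phi> \<star> F) = \<psi> \<star> F" "{} \<notin> r1 (\<phi> \<star> F)" "\<forall>x. {x} \<notin> r1 (\<phi> \<star> F)"
    moreover have "closed_for G \<psi>"
      by (rule closed_for_if_no_unit[OF clauses]) (use r in auto)
    ultimately show thesis using closed by blast
  qed
qed

lemma closed_model:
  assumes "closed_for G \<psi>"
  obtains f where "\<psi> \<subseteq>\<^sub>m Some \<circ> f" "v \<notin> dom \<psi> \<Longrightarrow> f v = b" "xor_satisfies (Some \<circ> f) G"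
proof -
  \<comment> \<open>An assigned \<open>v\<close> has to keep its value; \<open>b\<close> takes
    effect only for a free \<open>v\<close>.\<close>
  let ?b = "if v \<in> dom \<psi> then the (\<psi> v) else b"
  have "\<psi> v \<in> {None, Some ?b}" by auto
  then obtain f where f: "\<psi> \<subseteq>\<^sub>m Some \<circ> f" "f v = ?b" "xor_satisfies (Some \<circ> f) G"
    using free assms unfolding freely_extendable_def by blast
  show thesis by (rule that[OF f(1) _ f(3)]) (use f(2) in simp)
qed

lemma closed_not_forced:
  assumes "closed_for G \<psi>"
  shows "\<not> forced x (\<psi> \<star> F)"
proof -
  obtain b where b: "assign_lit x False = [lit_var x \<mapsto> b]" by (cases x) auto
  obtain f where f: "\<psi> \<subseteq>\<^sub>m Some \<circ> f" "lit_var x \<notin> dom \<psi> \<Longrightarrow> f (lit_var x) = b"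
      "xor_satisfies (Some \<circ> f) G"
    using closed_model[OF assms] by metis
  have "cnf_models f (\<psi> \<star> F)"
    using f(3) by (simp only: cnf_models_apply[OF f(1)] cnf_models_Union_X0_iff[OF clauses])
  \<comment> \<open>If the variable of \<open>x\<close> is free, \<open>f\<close> already gives it
    the value \<open>b\<close> that falsifies \<open>x\<close>; if it is assigned, it no longer
    occurs in \<open>\<psi> \<star> F\<close>. Either way the update is harmless.\<close>
  moreover have "f v = (f(lit_var x := b)) v" if "v \<in> var_set (\<psi> \<star> F)" for v
    using that f(2) var_set_apply[of \<psi> F] by auto
  ultimately have "cnf_models (f(lit_var x := b)) (\<psi> \<star> F)"
    using cnf_models_cong by blast
  moreover have "assign_lit x False \<subseteq>\<^sub>m Some \<circ> f(lit_var x := b)" by (simp add: b map_le_def)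
  ultimately show ?thesis
    unfolding forced_def
      satisfiable_apply_iff[OF finite_var_set[OF is_clause_set_apply[OF clause_set]]] by blast
qed

text \<open>A closed extension always has a model, so propagation can avoid the conflict only on a
  satisfiable clause-set.\<close>

lemma forcing:
  assumes "partial_assignment \<phi>"
  shows "\<not> satisfiable (\<phi> \<star> F) \<and> r1 (\<phi> \<star> F) = {{}} \<or>
    satisfiable (\<phi> \<star> F) \<and> (\<forall>x. \<not> forced x (r1 (\<phi> \<star> F)))"
  using assms
proof (cases rule: r1_cases)
  case conflict
  then show ?thesis by blast
next
  case (closed \<psi>)
  obtain f where f: "\<psi> \<subseteq>\<^sub>m Some \<circ> f" "xor_satisfies (Some \<circ> f) G"
    using closed_model[OF closed(3)] by metis
  have "\<phi> \<subseteq>\<^sub>m Some \<circ> f" using closed(1) f(1) map_le_trans by blast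
  then have "satisfiable (\<phi> \<star> F)" using f(2) satisfiable_apply_xor_iff by blast
  then show ?thesis using closed_not_forced[OF closed(3)] closed(2) by simp
qed

text \<open>A variable left unassigned by unit propagation could take both values.\<close>

lemma r1_empty_if_unique_model:
  assumes \<phi>: "partial_assignment \<phi>" and sat: "satisfiable (\<phi> \<star> F)"
    and unique: "\<And>f g v. \<phi> \<subseteq>\<^sub>m Some \<circ> f \<Longrightarrow> \<phi> \<subseteq>\<^sub>m Some \<circ> g \<Longrightarrow>
      xor_satisfies (Some \<circ> f) G \<Longrightarrow> xor_satisfies (Some \<circ> g) G \<Longrightarrow> v \<in> var_set G \<Longrightarrow> f v = g v"
  shows "r1 (\<phi> \<star> F) = {}"
  using \<phi>
proof (cases rule: r1_cases)
  case conflict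
  then show ?thesis using sat by blast
next
  case (closed \<psi>)
  have le: "\<phi> \<subseteq>\<^sub>m Some \<circ> f" if "\<psi> \<subseteq>\<^sub>m Some \<circ> f" for f using closed(1) that map_le_trans by blast
  have dom: "v \<in> dom \<psi>" if v: "v \<in> var_set G" for v
  proof (rule ccontr)
    assume nd: "v \<notin> dom \<psi>"
    obtain f where f: "\<psi> \<subseteq>\<^sub>m Some \<circ> f" "f v" "xor_satisfies (Some \<circ> f) G"
      using closed_model[OF closed(3), of v True] nd by metis
    obtain g where g: "\<psi> \<subseteq>\<^sub>m Some \<circ> g" "\<not> g v" "xor_satisfies (Some \<circ> g) G"
      using closed_model[OF closed(3), of v False] nd by metis
    show False using unique[OF le[OF f(1)] le[OF g(1)] f(3) g(3) v] f(2) g(2) by blast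
  qed
  obtain f where f: "\<psi> \<subseteq>\<^sub>m Some \<circ> f" "xor_satisfies (Some \<circ> f) G"
    using closed_model[OF closed(3)] by metis
  then have "cnf_models f F" by (simp only: cnf_models_Union_X0_iff[OF clauses])
  then have "cnf_models f (\<psi> \<star> F)" by (simp only: cnf_models_apply[OF f(1)])
  \<comment> \<open>Without variables the remaining clause-set can contain at most the empty clause,
    which the model \<open>f\<close> excludes.\<close>
  moreover have "var_set (\<psi> \<star> F) = {}"
    using var_set_apply[of \<psi> F] var_set_Union_X0[OF clauses] dom by blast
  ultimately have "\<psi> \<star> F = {}"
    unfolding cnf_models_def var_set_def var_clause_def by blast
  then show ?thesis using closed(2) by simp
qed

end

section \<open>Splitting an XOR-clause-set\<close>

locale split_system =
  fixes F :: "'v clauses" and ord :: "'v clause \<Rightarrow> 'v lit list" and y :: "'v clause \<Rightarrow> nat \<Rightarrow> 'v"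
  assumes choice: "splitting_choice F ord y" and clauses: "\<And>K. K \<in> F \<Longrightarrow> is_clause K"
begin

abbreviation G where "G \<equiv> \<Union>K\<in>F. natural_splitting (ord K) (y K)"

lemma ord: "K \<in> F \<Longrightarrow> distinct (ord K)" "K \<in> F \<Longrightarrow> set (ord K) = K"
  using choice by (auto simp: splitting_choice_def)

lemma length_ord: "K \<in> F \<Longrightarrow> length (ord K) = card K"
  using ord distinct_card by metis

lemma new_fresh: "K \<in> F \<Longrightarrow> y K ` {2..card K - 1} \<inter> var_set F = {}"
  using choice by (auto simp: splitting_choice_def)

lemma new_disjoint:
  "K \<in> F \<Longrightarrow> L \<in> F \<Longrightarrow> K \<noteq> L \<Longrightarrow> y K ` {2..card K - 1} \<inter> y L ` {2..card L - 1} = {}"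
  using choice unfolding splitting_choice_def by blast

lemma new_inj:
  assumes "K \<in> F" "L \<in> F" "i \<in> {2..card K - 1}" "j \<in> {2..card L - 1}" "y K i = y L j"
  shows "K = L \<and> i = j"
proof -
  have "K = L" using new_disjoint[OF assms(1,2)] assms(3-5) by blast
  moreover have "inj_on (y K) {2..card K - 1}" using choice assms(1) by (auto simp: splitting_choice_def)
  ultimately show ?thesis using assms(3-5) inj_onD by metis
qed

lemma splitting: "K \<in> F \<Longrightarrow> splitting (ord K) (y K)"
proof
  assume K: "K \<in> F"
  then show "distinct (ord K)" "is_clause (set (ord K))" using ord clauses by auto
  show "inj_on (y K) {2..length (ord K) - 1}"
    using choice K by (auto simp: splitting_choice_def length_ord)
  have "var_clause K \<subseteq> var_set F" using K by (auto simp: var_set_def)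
  then show "y K ` {2..length (ord K) - 1} \<inter> var_clause (set (ord K)) = {}"
    using new_fresh[OF K] K by (auto simp: length_ord ord)
qed

lemma split_clauses: "\<forall>E\<in>G. is_clause E"
  using splitting.natural_splitting_clauses[OF splitting] by blast

lemma var_set_split:
  assumes "K \<in> F"
  shows "var_set (natural_splitting (ord K) (y K)) = var_clause K \<union> y K ` {2..card K - 1}"
  using splitting.var_set_natural_splitting[OF splitting[OF assms]] assms
  by (simp add: ord length_ord)

lemma var_set_G: "var_set G = var_set F \<union> (\<Union>K\<in>F. y K ` {2..card K - 1})"
proof -
  have "var_set G = (\<Union>K\<in>F. var_set (natural_splitting (ord K) (y K)))" by (simp add: var_set_def)
  also have "\<dots> = (\<Union>K\<in>F. var_clause K \<union> y K ` {2..card K - 1})" by (simp add: var_set_split)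
  finally show ?thesis by (simp add: UN_Un_distrib var_set_def)
qed

lemma finite_split: "finite F \<Longrightarrow> finite G"
proof (rule finite_UN_I)
  fix K
  have "{f i | i. 3 \<le> i \<and> i \<le> m} = f ` {3..m}" for f :: "nat \<Rightarrow> 'v clause" and m by auto
  then show "finite (natural_splitting (ord K) (y K))"
    by (simp add: natural_splitting_def Let_def)
qed

definition prefix_sum :: "('v \<Rightarrow> bool) \<Rightarrow> 'v clause \<Rightarrow> nat \<Rightarrow> bit" where
  "prefix_sum f K i = (\<Sum>j<i. lit_val (Some \<circ> f) (ord K ! j))"

lemma xor_satisfies_split:
  "xor_satisfies (Some \<circ> f) G \<longleftrightarrow> xor_satisfies (Some \<circ> f) F \<and>
    (\<forall>K\<in>F. \<forall>i\<in>{2..card K - 1}. f (y K i) = (prefix_sum f K i = 1))"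
proof -
  have "xor_satisfies (Some \<circ> f) G \<longleftrightarrow>
      (\<forall>K\<in>F. xor_satisfies (Some \<circ> f) (natural_splitting (ord K) (y K)))"
    by (simp only: xor_satisfies_def ball_UN)
  also have "\<dots> \<longleftrightarrow> (\<forall>K\<in>F. xor_satisfies (Some \<circ> f) {K} \<and>
      (\<forall>i\<in>{2..card K - 1}. f (y K i) = (prefix_sum f K i = 1)))"
    by (rule ball_cong[OF refl])
      (simp only: splitting.xor_satisfies_natural_splitting[OF splitting] length_ord ord
        lit_val_Pos_eq_iff prefix_sum_def)
  also have "\<dots> \<longleftrightarrow> xor_satisfies (Some \<circ> f) F \<and>
    (\<forall>K\<in>F. \<forall>i\<in>{2..card K - 1}. f (y K i) = (prefix_sum f K i = 1))"
    unfolding xor_satisfies_def by (simp only: ball_conj_distrib ball_simps simp_thms)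
  finally show ?thesis .
qed

lemma prefix_sum_cong:
  assumes "\<And>v. v \<in> var_set F \<Longrightarrow> f v = g v" "K \<in> F" "i \<in> {2..card K - 1}"
  shows "prefix_sum f K i = prefix_sum g K i"
  unfolding prefix_sum_def
proof (rule sum.cong[OF refl])
  fix j assume "j \<in> {..<i}"
  then have "ord K ! j \<in> K" using assms(2,3) nth_mem[of j "ord K"] by (auto simp: ord length_ord)
  then have "lit_var (ord K ! j) \<in> var_set F" using assms(2) by (auto simp: var_set_def var_clause_def)
  then show "lit_val (Some \<circ> f) (ord K ! j) = lit_val (Some \<circ> g) (ord K ! j)"
    using assms(1) by (cases "ord K ! j") auto
qed

text \<open>In a model each splitting variable is a prefix sum of old literals and is thus
  determined by the variables of \<open>F\<close>.\<close>

lemma split_unique: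
  assumes "xor_satisfies (Some \<circ> f) G" "xor_satisfies (Some \<circ> g) G"
    and eq: "\<And>v. v \<in> var_set F \<Longrightarrow> f v = g v" and v: "v \<in> var_set G"
  shows "f v = g v"
proof (cases "v \<in> var_set F")
  case False
  then obtain K i where Ki: "K \<in> F" "i \<in> {2..card K - 1}" "v = y K i" using v var_set_G by auto
  then show ?thesis using assms(1,2) prefix_sum_cong[OF eq Ki(1,2)] by (simp only: xor_satisfies_split)
qed (rule eq)

lemma split_extend:
  assumes "xor_satisfies (Some \<circ> f) F"
  obtains g where "xor_satisfies (Some \<circ> g) G" "\<And>v. v \<in> var_set F \<Longrightarrow> g v = f v"
proof
  \<comment> \<open>Every splitting variable receives its prefix sum. The existential is unambiguous
    because \<open>new_inj\<close> recovers \<open>K\<close> and \<open>i\<close> from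
    \<open>y K i\<close>; variables foreign to the system become False.\<close>
  let ?g = "\<lambda>v. if v \<in> var_set F then f v
    else \<exists>K\<in>F. \<exists>i\<in>{2..card K - 1}. v = y K i \<and> prefix_sum f K i = 1"
  show eq: "?g v = f v" if "v \<in> var_set F" for v using that by simp
  have "xor_satisfies (Some \<circ> ?g) F"
    using xor_satisfies_cong[of F "Some \<circ> ?g" "Some \<circ> f"] assms by simp
  moreover have "?g (y K i) = (prefix_sum ?g K i = 1)" if "K \<in> F" "i \<in> {2..card K - 1}" for K i
  proof -
    have "y K i \<notin> var_set F" using new_fresh[OF that(1)] that(2) by blast
    then have "?g (y K i) = (\<exists>L\<in>F. \<exists>j\<in>{2..card L - 1}. y K i = y L j \<and> prefix_sum f L j = 1)"
      by (simp only: if_False)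
    also have "\<dots> = (prefix_sum f K i = 1)" using new_inj that by metis
    also have "prefix_sum f K i = prefix_sum ?g K i" by (rule prefix_sum_cong[OF _ that]) simp
    finally show ?thesis .
  qed
  ultimately show "xor_satisfies (Some \<circ> ?g) G" unfolding xor_satisfies_split by blast
qed

end

section \<open>Two XOR-clauses with a common part\<close>

lemma var_clause_Un: "var_clause (A \<union> B) = var_clause A \<union> var_clause B"
  by (auto simp: var_clause_def)

lemma var_clause_Diff: "is_clause C \<Longrightarrow> I \<subseteq> C \<Longrightarrow> var_clause (C - I) = var_clause C - var_clause I"
  unfolding var_clause_def by (rule inj_on_image_set_diff[OF clause_inj_on_var]) auto

lemma is_clause_subset: "is_clause C \<Longrightarrow> A \<subseteq> C \<Longrightarrow> is_clause A"
  by (auto simp: is_clause_def intro: finite_subset)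

lemma Pos_notin_if_fresh: "v \<notin> var_clause A \<Longrightarrow> Pos v \<notin> A"
  by (force simp: var_clause_def)

lemma is_clause_insert_fresh:
  assumes "is_clause C" "s \<notin> var_clause C"
  shows "is_clause (C \<union> {Pos s})"
proof -
  have "lit_neg x \<noteq> Pos s \<and> x \<noteq> Neg s" if "x \<in> C" for x
  proof -
    have "lit_var x \<noteq> s" using that assms(2) by (auto simp: var_clause_def)
    then show ?thesis by (cases x) auto
  qed
  then show ?thesis using assms(1) by (auto simp: is_clause_def)
qed

locale shared_xors =
  fixes C D I I' C' D' :: "'v clause" and s :: 'v
  assumes C: "is_clause C" and D: "is_clause D"
    and I: "I = C \<inter> D"
    and shared: "var_clause C \<inter> var_clause D = var_clause I"
    and I_ne: "card I \<ge> 2" and C_card: "card C > card I"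
    and s: "s \<notin> var_clause C \<union> var_clause D"
    and I': "I' = I \<union> {Pos s}"
    and C': "C' = (C - I) \<union> {Pos s}"
    and D': "D' = (D - I) \<union> {Pos s}"
begin

lemma I_sub: "I \<subseteq> C" "I \<subseteq> D"
  using I by auto

lemma var_I': "var_clause I' = insert s (var_clause I)"
  and var_C': "var_clause C' = insert s (var_clause C - var_clause I)"
  and var_D': "var_clause D' = insert s (var_clause D - var_clause I)"
  unfolding I' C' D' var_clause_Un var_clause_Diff[OF C I_sub(1)] var_clause_Diff[OF D I_sub(2)]
  by (auto simp: var_clause_def)

lemma var_I_sub: "var_clause I \<subseteq> var_clause C \<inter> var_clause D"
  using shared by simp

lemma var_set_parts: "var_set {I', C', D'} = insert s (var_set {C, D})"
  using var_I_sub by (auto simp: var_set_insert var_set_empty var_I' var_C' var_D')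

lemma s_fresh: "s \<notin> var_set {C, D}"
  using s by (simp add: var_set_insert var_set_empty)

lemma is_clause_parts: "K \<in> {I', C', D'} \<Longrightarrow> is_clause K"
proof -
  have "is_clause I" "is_clause (C - I)" "is_clause (D - I)"
    using is_clause_subset[OF C] is_clause_subset[OF D] I_sub by blast+
  moreover have "s \<notin> var_clause I" "s \<notin> var_clause (C - I)" "s \<notin> var_clause (D - I)"
    using s I_sub unfolding var_clause_def by blast+
  ultimately have "is_clause I'" "is_clause C'" "is_clause D'"
    unfolding I' C' D' by (simp_all only: is_clause_insert_fresh not_False_eq_True)
  then show "K \<in> {I', C', D'} \<Longrightarrow> is_clause K" by blast
qed

text \<open>Needed because \<open>splitting_choice\<close> separates new variables only for
  different XOR-clauses. An element of \<open>I\<close> singles out \<open>I'\<close>, and an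
  element of \<open>C - I\<close> separates \<open>C'\<close> from \<open>D'\<close>.\<close>

lemma parts_distinct: "I' \<noteq> C'" "I' \<noteq> D'" "C' \<noteq> D'"
proof -
  have "Pos s \<notin> C" using s by (simp add: Pos_notin_if_fresh)
  moreover obtain x where x: "x \<in> I" using I_ne by fastforce
  moreover obtain z where z: "z \<in> C" "z \<notin> I"
    using C_card I_sub(1) by (metis less_irrefl subsetI subset_antisym)
  ultimately have "x \<in> I'" "x \<notin> C'" "x \<notin> D'" "z \<in> C'" "z \<notin> D'"
    using I_sub unfolding I' C' D' I by auto
  then show "I' \<noteq> C'" "I' \<noteq> D'" "C' \<noteq> D'" by metis+
qed

text \<open>The clause \<open>I'\<close> defines \<open>s\<close> as the sum over \<open>I\<close>.
  Substituting this for \<open>s\<close> in \<open>C'\<close> and \<open>D'\<close> restores the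
  full sums over \<open>C\<close> and \<open>D\<close>.\<close>

lemma xor_satisfies_parts:
  "xor_satisfies \<phi> {I', C', D'} \<longleftrightarrow>
    lit_val \<phi> (Pos s) = (\<Sum>x\<in>I. lit_val \<phi> x) \<and> xor_satisfies \<phi> {C, D}"
proof -
  let ?v = "lit_val \<phi>"
  have fin: "finite C" "finite D" "finite I"
    using C D I by (auto simp: is_clause_def)
  have "Pos s \<notin> C" "Pos s \<notin> D" using s by (simp_all add: Pos_notin_if_fresh)
  then have n: "Pos s \<notin> I" "Pos s \<notin> C - I" "Pos s \<notin> D - I" using I_sub by auto
  have "sum ?v I' = ?v (Pos s) + sum ?v I" "sum ?v C' = ?v (Pos s) + sum ?v (C - I)"
      "sum ?v D' = ?v (Pos s) + sum ?v (D - I)"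
    unfolding I' C' D' using n fin by (simp_all only: Un_insert_right Un_empty_right sum.insert finite_Diff
        not_False_eq_True)
  moreover have "sum ?v C = sum ?v (C - I) + sum ?v I" "sum ?v D = sum ?v (D - I) + sum ?v I"
    by (rule sum.subset_diff[OF I_sub(1) fin(1)], rule sum.subset_diff[OF I_sub(2) fin(2)])
  ultimately show ?thesis
    unfolding xor_satisfies_def by (simp only: ball_simps simp_thms bit_add_eq_0_iff) metis
qed

lemma represents: "xor_represents {I', C', D'} {C, D}"
  unfolding xor_represents_def
proof (intro equalityI subsetI)
  let ?V = "var_set {C, D}"
  fix \<phi> assume "\<phi> \<in> (\<lambda>\<phi>. \<phi> |` ?V) ` xor_models {I', C', D'}"
  then obtain \<theta> where \<theta>: "\<phi> = \<theta> |` ?V" "dom \<theta> = insert s ?V" "xor_satisfies \<theta> {C, D}"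
    by (auto simp: xor_models_def total_for_def var_set_parts xor_satisfies_parts)
  have "xor_satisfies \<phi> {C, D}"
    using \<theta>(3) xor_satisfies_cong[of "{C, D}" \<phi> \<theta>] \<theta>(1) by simp
  moreover have "dom \<phi> = ?V" using \<theta>(1,2) by auto
  ultimately show "\<phi> \<in> xor_models {C, D}" by (simp add: xor_models_def total_for_def)
next
  let ?V = "var_set {C, D}"
  fix \<phi> assume "\<phi> \<in> xor_models {C, D}"
  then have \<phi>: "dom \<phi> = ?V" "xor_satisfies \<phi> {C, D}" by (auto simp: xor_models_def total_for_def)
  \<comment> \<open>The value of \<open>s\<close> is dictated by the clause
    \<open>I'\<close>.\<close>
  let ?\<theta> = "\<phi>(s \<mapsto> ((\<Sum>x\<in>I. lit_val \<phi> x) = 1))"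
  have "(\<Sum>x\<in>I. lit_val ?\<theta> x) = (\<Sum>x\<in>I. lit_val \<phi> x)"
    by (rule sum_lit_val_cong) (use s var_I_sub in auto)
  moreover have "lit_val ?\<theta> (Pos s) = (\<Sum>x\<in>I. lit_val \<phi> x)"
    by (cases "\<Sum>x\<in>I. lit_val \<phi> x") simp_all
  moreover have "xor_satisfies ?\<theta> {C, D}"
  proof (rule iffD2[OF xor_satisfies_cong \<phi>(2)])
    show "?\<theta> v = \<phi> v" if "v \<in> ?V" for v using that s_fresh by auto
  qed
  ultimately have "xor_satisfies ?\<theta> {I', C', D'}" by (simp only: xor_satisfies_parts)
  moreover have "dom ?\<theta> = insert s ?V" using \<phi>(1) by simp
  ultimately have "?\<theta> \<in> xor_models {I', C', D'}"
    by (simp only: xor_models_def total_for_def var_set_parts mem_Collect_eq)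
  moreover have "?\<theta> |` ?V = \<phi>"
  proof
    show "(?\<theta> |` ?V) v = \<phi> v" for v
      using s_fresh \<phi>(1) domIff[of v \<phi>] by (cases "v \<in> ?V") (auto simp: restrict_map_def)
  qed
  ultimately show "\<phi> \<in> (\<lambda>\<phi>. \<phi> |` ?V) ` xor_models {I', C', D'}" by (metis (no_types, lifting) image_eqI)
qed

lemma absolute_forcing:
  assumes "splitting_choice {I', C', D'} ord y"
  shows "absolute_forcing_representation (X1 ord y {I', C', D'}) {C, D}"
proof -
  let ?P = "{I', C', D'}" and ?V = "var_set {C, D}"
  interpret split_system ?P ord y by unfold_locales (rule assms, rule is_clause_parts)
  let ?N = "\<lambda>K. natural_splitting (ord K) (y K)" and ?Y = "\<lambda>K. y K ` {2..card K - 1}"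
  have vN: "var_set (?N K) = var_clause K \<union> ?Y K" if "K \<in> ?P" for K using that by (rule var_set_split)
  have freeN: "freely_extendable (?N K)" if "K \<in> ?P" for K
    using splitting.freely_extendable_natural_splitting[OF splitting[OF that]] .
  \<comment> \<open>New variables are disjoint from each other and from all old ones, so splitting
    creates no further sharing.\<close>
  have inter: "var_set (?N K) \<inter> var_set (?N L) \<subseteq> var_clause K \<inter> var_clause L"
    if "K \<in> ?P" "L \<in> ?P" "K \<noteq> L" for K L
  proof -
    have "var_clause K \<subseteq> var_set ?P" "var_clause L \<subseteq> var_set ?P"
      using that unfolding var_set_def by blast+
    then show ?thesis
      using new_fresh[OF that(1)] new_fresh[OF that(2)] new_disjoint[OF that]
      unfolding vN[OF that(1)] vN[OF that(2)] by blast
  qed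
  have cap: "var_clause I' \<inter> var_clause C' \<subseteq> {s}" "var_clause I' \<inter> var_clause D' \<subseteq> {s}"
      "var_clause C' \<inter> var_clause D' \<subseteq> {s}"
    unfolding var_I' var_C' var_D' using shared by blast+
  \<comment> \<open>Any two of the three splittings meet at most in \<open>s\<close>, hence so do
    the union of two of them and the third; gluing along \<open>s\<close> can be done twice.\<close>
  have "freely_extendable ((?N I' \<union> ?N C') \<union> ?N D')"
  proof (intro freely_extendable_Un[where w = s] freeN)
    show "var_set (?N I') \<inter> var_set (?N C') \<subseteq> {s}"
      using inter[of I' C'] cap(1) parts_distinct by blast
    show "var_set (?N I' \<union> ?N C') \<inter> var_set (?N D') \<subseteq> {s}"
      using inter[of I' D'] inter[of C' D'] cap(2,3) parts_distinct unfolding var_set_Un by blast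
  qed simp_all
  moreover have "G = (?N I' \<union> ?N C') \<union> ?N D'" by auto
  ultimately have free: "freely_extendable G" by simp
  interpret free_xor_system G
    by unfold_locales (rule finite_split, simp, rule split_clauses, rule free)
  have X1: "X1 ord y ?P = (\<Union>E\<in>G. X0 E)" unfolding X1_def by blast
  have sat_iff: "satisfiable (\<phi> \<star> (\<Union>E\<in>G. X0 E)) \<longleftrightarrow> xor_satisfies \<phi> {C, D}"
    if \<phi>: "total_for \<phi> ?V" for \<phi>
  proof -
    have dom: "dom \<phi> = ?V" using \<phi> by (simp add: total_for_def)
    have eq: "\<phi> v = (Some \<circ> f) v" if "\<phi> \<subseteq>\<^sub>m Some \<circ> f" "v \<in> ?V" for f v
      using that dom unfolding map_le_def by blast
    have "xor_satisfies \<phi> {C, D}" if "\<phi> \<subseteq>\<^sub>m Some \<circ> f" "xor_satisfies (Some \<circ> f) G" for f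
      using that(2) xor_satisfies_cong[of "{C, D}" \<phi> "Some \<circ> f", OF eq[OF that(1)]]
      unfolding xor_satisfies_split xor_satisfies_parts by blast
    moreover have "\<exists>f. \<phi> \<subseteq>\<^sub>m Some \<circ> f \<and> xor_satisfies (Some \<circ> f) G" if sat: "xor_satisfies \<phi> {C, D}"
    proof -
      \<comment> \<open>The assignment is extended in two stages: \<open>represents\<close> supplies
        a value for \<open>s\<close>, then \<open>split_extend\<close> supplies the splitting
        variables.\<close>
      have "\<phi> \<in> (\<lambda>\<phi>. \<phi> |` ?V) ` xor_models ?P"
        using sat \<phi> represents by (simp add: xor_represents_def xor_models_def)
      then obtain \<theta> where \<theta>: "\<phi> = \<theta> |` ?V" "dom \<theta> = var_set ?P" "xor_satisfies \<theta> ?P"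
        by (auto simp: xor_models_def total_for_def)
      let ?f = "\<lambda>v. the (\<theta> v)"
      have \<theta>_eq: "\<theta> v = (Some \<circ> ?f) v" if "v \<in> var_set ?P" for v
        using that \<theta>(2) domD[of v \<theta>] by auto
      then have "xor_satisfies (Some \<circ> ?f) ?P" using \<theta>(3) xor_satisfies_cong by blast
      then obtain g where g: "xor_satisfies (Some \<circ> g) G" "\<And>v. v \<in> var_set ?P \<Longrightarrow> g v = ?f v"
        by (rule split_extend) blast
      have "\<phi> \<subseteq>\<^sub>m Some \<circ> g"
        unfolding map_le_total_iff dom using g(2) \<theta>(1) var_set_parts by simp
      then show ?thesis using g(1) by blast
    qed
    ultimately show ?thesis unfolding satisfiable_apply_xor_iff by blast
  qed
  have "cnf_representation (\<Union>E\<in>G. X0 E) {C, D}"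
  proof -
    have "?V \<subseteq> var_set (\<Union>E\<in>G. X0 E)"
      unfolding var_set_Union_X0[OF split_clauses] var_set_G var_set_parts by blast
    then show ?thesis unfolding cnf_representation_def using clause_set sat_iff by blast
  qed
  moreover have "r1 (\<phi> \<star> (\<Union>E\<in>G. X0 E)) = {}"
    if \<phi>: "total_for \<phi> ?V" and sat: "satisfiable (\<phi> \<star> (\<Union>E\<in>G. X0 E))" for \<phi>
  proof (rule r1_empty_if_unique_model[OF _ sat])
    have dom: "dom \<phi> = ?V" using \<phi> by (simp add: total_for_def)
    have "finite ?V" using C D by (simp add: var_set_insert var_set_empty var_clause_def is_clause_def)
    then show "partial_assignment \<phi>" by (simp add: partial_assignment_def dom)
    fix f g v
    assume fg: "\<phi> \<subseteq>\<^sub>m Some \<circ> f" "\<phi> \<subseteq>\<^sub>m Some \<circ> g"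
      and sat: "xor_satisfies (Some \<circ> f) G" "xor_satisfies (Some \<circ> g) G" and v: "v \<in> var_set G"
    have eq: "f v = g v" if "v \<in> ?V" for v
      using fg that unfolding map_le_total_iff dom by simp
    \<comment> \<open>Both models agree on \<open>I\<close>, so the equation for \<open>s\<close>
      fixes its value; the splitting variables then follow by \<open>split_unique\<close>.\<close>
    have "(\<Sum>x\<in>I. lit_val (Some \<circ> f) x) = (\<Sum>x\<in>I. lit_val (Some \<circ> g) x)"
      by (rule sum_lit_val_cong) (use eq var_I_sub in \<open>auto simp: var_set_insert var_set_empty\<close>)
    then have "lit_val (Some \<circ> f) (Pos s) = lit_val (Some \<circ> g) (Pos s)"
      using sat unfolding xor_satisfies_split xor_satisfies_parts by simp
    then have "f s = g s" by (cases "f s"; cases "g s") simp_all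
    then have "f w = g w" if "w \<in> var_set ?P" for w
      using that eq unfolding var_set_parts by blast
    then show "f v = g v" using split_unique[OF sat _ v] by blast
  qed
  ultimately show ?thesis
    unfolding absolute_forcing_representation_def X1 using forcing by blast
qed

end

theorem theorem13p1:
  fixes C D I I' C' D' :: "'v clause" and s :: 'v
  assumes "is_clause C" and "is_clause D"
    and "I = C \<inter> D"
    and "var_clause C \<inter> var_clause D = var_clause I"
    and "card I \<ge> 2" and "card C > card I" and "card D > card I"
    and "s \<notin> var_clause C \<union> var_clause D"
    and "I' = I \<union> {Pos s}"
    and "C' = (C - I) \<union> {Pos s}"
    and "D' = (D - I) \<union> {Pos s}"
  shows "xor_represents {I', C', D'} {C, D} \<and>
    (\<forall>ord y. splitting_choice {I', C', D'} ord y \<longrightarrow>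
       absolute_forcing_representation (X1 ord y {I', C', D'}) {C, D})"
proof -
  interpret shared_xors C D I I' C' D' s by unfold_locales (rule assms)+
  show ?thesis using represents absolute_forcing by blast
qed

end
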